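(* Let $\boldsymbol E\in\mathbb R^d$, let $\boldsymbol N=(N_1,\dots,N_d)$ with all $N_\alpha$ odd positive integers, and let $\boldsymbol A\in C^0_\#(\mathcal Y;\mathbb R^{d\times d})$ be such that there are constants $0<c_A\le C_A<+\infty$ for which, for a.e. $\boldsymbol x\in\mathcal Y$, $\boldsymbol A(\boldsymbol x)$ is symmetric and $c_A\|\boldsymbol v\|_{\mathbb R^d}^2\le(\boldsymbol A(\boldsymbol x)\boldsymbol v,\boldsymbol v)_{\mathbb R^d}\le C_A\|\boldsymbol v\|_{\mathbb R^d}^2$ for all $\boldsymbol v\in\mathbb R^d$. Let $\boldsymbol A^{(0)}\in\mathbb R^{d\times d}$ be symmetric with $c_A^{(0)}\|\boldsymbol v\|_{\mathbb R^d}^2\le(\boldsymbol A^{(0)}\boldsymbol v,\boldsymbol v)_{\mathbb R^d}\le C_A^{(0)}\|\boldsymbol v\|_{\mathbb R^d}^2$ for all $\boldsymbol v\in\mathbb R^d$, where $0<c_A^{(0)}\le C_A^{(0)}<+\infty$. Let $\tilde{\boldsymbol e}_{\boldsymbol N}\in\mathscr E_{\boldsymbol N}$ be the (unique) solution of the Galerkin approximation with numerical integration, $(\mathcal Q_{\boldsymbol N}[\boldsymbol A\tilde{\boldsymbol e}_{\boldsymbol N}],\boldsymbol v_{\boldsymbol N})_{L^2_\#(\mathcal Y;\mathbb R^d)}=-(\mathcal Q_{\boldsymbol N}[\boldsymbol A\boldsymbol E],\boldsymbol v_{\boldsymbol N})_{L^2_\#(\mathcal Y;\mathbb R^d)}$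 for all $\boldsymbol v_{\boldsymbol N}\in\mathscr E_{\boldsymbol N}$. Then: (i) the unique $\tilde{\mathsf e}_{\boldsymbol N}\in\mathbb E_{\boldsymbol N}$ satisfying $$(\mathsf A_{\boldsymbol N}\tilde{\mathsf e}_{\boldsymbol N},\mathsf v)_{\mathbb R^{d\times\boldsymbol N}}=-(\mathsf A_{\boldsymbol N}\mathsf E_{\boldsymbol N},\mathsf v)_{\mathbb R^{d\times\boldsymbol N}}\quad\text{for all }\mathsf v\in\mathbb E_{\boldsymbol N}\qquad( * )$$ is given by $\tilde{\mathsf e}_{\boldsymbol N}=\mathcal I_{\boldsymbol N}[\tilde{\boldsymbol e}_{\boldsymbol N}]$; (ii) the unique solution $\mathsf e_{\boldsymbol N}\in\mathbb R^{d\times\boldsymbol N}$ to the discrete Lippmann--Schwinger equation $$\bigl[\mathsf I+\mathsf\Gamma^{(0)}_{\boldsymbol N}(\mathsf A_{\boldsymbol N}-\mathsf A^{(0)}_{\boldsymbol N})\bigr]\mathsf e_{\boldsymbol N}=\mathsf E_{\boldsymbol N}$$ satisfies $\mathsf e_{\boldsymbol N}=\mathsf E_{\boldsymbol N}+\tilde{\mathsf e}_{\boldsymbol N}$; (iii) for $\boldsymbol A^{(0)}=\lambda\boldsymbol I$ with $\lambda>0$, problem $( * )$ is equivalent to the linear system for $\tilde{\mathsf e}_{\boldsymbol N}\in\mathbb E_{\boldsymbol N}$ $$\mathsf G_{\boldsymbol N}\mathsf A_{\boldsymbol N}\tilde{\mathsf e}_{\boldsymbol N}=-\mathsf G_{\boldsymbol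 N}\mathsf A_{\boldsymbol N}\mathsf E_{\boldsymbol N}.$$
   Context: Let $\mathcal Y=\prod_{\alpha=1}^d[-Y_\alpha,Y_\alpha]\subset\mathbb R^d$ with $Y_\alpha>0$, $|\mathcal Y|=2^d\prod_\alpha Y_\alpha$. $L^2_\#(\mathcal Y;\mathbb X)$ and $C^0_\#(\mathcal Y;\mathbb X)$ are the spaces of $\mathcal Y$-periodic (period $2Y_\alpha$ in direction $\alpha$) functions $\mathbb R^d\to\mathbb X$ that are locally square-integrable, resp. continuous; $(\boldsymbol u,\boldsymbol v)_{L^2_\#}=\frac1{|\mathcal Y|}\int_{\mathcal Y}(\boldsymbol u(\boldsymbol x),\boldsymbol v(\boldsymbol x))_{\mathbb X}\,d\boldsymbol x$. For $\boldsymbol k\in\mathbb Z^d$ put $\boldsymbol\xi(\boldsymbol k)=(k_\alpha/Y_\alpha)_\alpha$, $\varphi_{\boldsymbol k}(\boldsymbol x)=\exp(\mathrm i\pi\,\boldsymbol\xi(\boldsymbol k)\cdot\boldsymbol x)$. $\mathscr E=\{\boldsymbol u\in L^2_\#(\mathcal Y;\mathbb R^d):\nabla\times\boldsymbol u=\boldsymbol 0,\ \int_{\mathcal Y}\boldsymbol u\,d\boldsymbol x=\boldsymbol 0\}$, where $\nabla\times\boldsymbol u=\boldsymbol 0$ means $\int_{\mathcal Y}(u_\alpha\partial_\beta v-u_\beta\partial_\alpha v)\,d\boldsymbol x=0$ for all $\alpha,\beta$ and all $v$ in the real periodic Sobolev space $H^1_\#(\mathcal Y)$. For $\boldsymbol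 N$ with odd entries: $\mathbb Z^d_{\boldsymbol N}=\{\boldsymbol m\in\mathbb Z^d:-N_\alpha/2\le m_\alpha<N_\alpha/2\}$, $h_\alpha=2Y_\alpha/N_\alpha$, $|\boldsymbol N|=\prod_\alpha N_\alpha$, grid points $\boldsymbol x^{\boldsymbol k}_{\boldsymbol N}=(k_\alpha h_\alpha)_\alpha$, $\boldsymbol k\in\mathbb Z^d_{\boldsymbol N}$. The trigonometric polynomials are $\mathscr T^d_{\boldsymbol N}=\{\sum_{\boldsymbol k\in\mathbb Z^d_{\boldsymbol N}}\widehat{\boldsymbol v}^{\boldsymbol k}\varphi_{\boldsymbol k}:\widehat{\boldsymbol v}^{\boldsymbol k}\in\mathbb C^d,\ \widehat{\boldsymbol v}^{\boldsymbol k}=\overline{\widehat{\boldsymbol v}^{-\boldsymbol k}}\}$, and $\mathscr E_{\boldsymbol N}=\mathscr E\cap\mathscr T^d_{\boldsymbol N}$. The interpolation operator is $\mathcal Q_{\boldsymbol N}[\boldsymbol u]=\sum_{\boldsymbol k\in\mathbb Z^d_{\boldsymbol N}}\boldsymbol u(\boldsymbol x^{\boldsymbol k}_{\boldsymbol N})\varphi_{\boldsymbol N,\boldsymbol k}$ for $\boldsymbol u\in C^0_\#(\mathcal Y;\mathbb R^d)$, with $\varphi_{\boldsymbol N,\boldsymbol k}(\boldsymbol x)=\frac1{|\boldsymbol N|}\sum_{\boldsymbol m\in\mathbb Z^d_{\boldsymbol N}}\exp\bigl\{\mathrm i\pi\sum_\alpha m_\alpha(\frac{x_\alpha}{Y_\alpha}-\frac{2k_\alpha}{N_\alpha})\bigr\}$.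 Discrete objects: $\mathbb R^{d\times\boldsymbol N}$ is the space of structured vectors $\mathsf v=(\mathsf v^{\boldsymbol k})_{\boldsymbol k\in\mathbb Z^d_{\boldsymbol N}}$, $\mathsf v^{\boldsymbol k}\in\mathbb R^d$, with scalar product $(\mathsf u,\mathsf v)_{\mathbb R^{d\times\boldsymbol N}}=\frac1{|\boldsymbol N|}\sum_{\boldsymbol k}(\mathsf u^{\boldsymbol k},\mathsf v^{\boldsymbol k})_{\mathbb R^d}$. Structured matrices $\mathsf M=(\mathsf M^{\boldsymbol k\boldsymbol m})_{\boldsymbol k,\boldsymbol m\in\mathbb Z^d_{\boldsymbol N}}$ with $d\times d$ blocks act by $(\mathsf M\mathsf v)^{\boldsymbol k}=\sum_{\boldsymbol m}\mathsf M^{\boldsymbol k\boldsymbol m}\mathsf v^{\boldsymbol m}$ and multiply blockwise; $\mathsf I$ is the identity. $\mathcal I_{\boldsymbol N}:C^0_\#(\mathcal Y;\mathbb R^d)\to\mathbb R^{d\times\boldsymbol N}$, $\mathcal I_{\boldsymbol N}[\boldsymbol u]=(\boldsymbol u(\boldsymbol x^{\boldsymbol k}_{\boldsymbol N}))_{\boldsymbol k}$, and $\mathbb E_{\boldsymbol N}=\mathcal I_{\boldsymbol N}[\mathscr E_{\boldsymbol N}]$. Data: $\mathsf A_{\boldsymbol N}^{\boldsymbol k\boldsymbol m}=\delta_{\boldsymbol k\boldsymbol m}\boldsymbol A(\boldsymbol x^{\boldsymbol k}_{\boldsymbol N})$, $(\mathsf A^{(0)}_{\boldsymbol N})^{\boldsymbol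 k\boldsymbol m}=\delta_{\boldsymbol k\boldsymbol m}\boldsymbol A^{(0)}$, $\mathsf E_{\boldsymbol N}^{\boldsymbol k}=\boldsymbol E$. Let $\widehat{\boldsymbol\Gamma}{}^{(0)}(\boldsymbol k)=\dfrac{\boldsymbol\xi(\boldsymbol k)\otimes\boldsymbol\xi(\boldsymbol k)}{(\boldsymbol A^{(0)}\boldsymbol\xi(\boldsymbol k),\boldsymbol\xi(\boldsymbol k))_{\mathbb R^d}}$ for $\boldsymbol k\neq\boldsymbol 0$, $\widehat{\boldsymbol\Gamma}{}^{(0)}(\boldsymbol 0)=\boldsymbol 0$; $(\widehat{\mathsf\Gamma}{}^{(0)}_{\boldsymbol N})^{\boldsymbol k\boldsymbol m}=\delta_{\boldsymbol k\boldsymbol m}\widehat{\boldsymbol\Gamma}{}^{(0)}(\boldsymbol k)$; $\omega^{\boldsymbol k\boldsymbol m}_{\boldsymbol N}=\exp(2\pi\mathrm i\sum_\alpha k_\alpha m_\alpha/N_\alpha)$; $\mathsf F_{\boldsymbol N}^{\boldsymbol k\boldsymbol m}=\frac1{|\boldsymbol N|}\omega_{\boldsymbol N}^{-\boldsymbol k\boldsymbol m}\boldsymbol I$ and $(\mathsf F_{\boldsymbol N}^{-1})^{\boldsymbol k\boldsymbol m}=\omega_{\boldsymbol N}^{\boldsymbol k\boldsymbol m}\boldsymbol I$ (discrete Fourier transform and inverse). Set $\mathsf\Gamma^{(0)}_{\boldsymbol N}=\mathsf F_{\boldsymbol N}^{-1}\widehat{\mathsf\Gamma}{}^{(0)}_{\boldsymbol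 N}\mathsf F_{\boldsymbol N}$, $\mathsf G^{(0)}_{\boldsymbol N}=\mathsf\Gamma^{(0)}_{\boldsymbol N}\mathsf A^{(0)}_{\boldsymbol N}$, and let $\mathsf G_{\boldsymbol N}$ be $\mathsf G^{(0)}_{\boldsymbol N}$ for $\boldsymbol A^{(0)}=\boldsymbol I$. *)

theory Defs
  imports "HOL-Analysis.Analysis" "HOL-Library.Function_Algebras"
begin

definition cell :: "real^'d \<Rightarrow> (real^'d) set" where
  "cell Y = cbox (- Y) Y"

definition cell_vol :: "real^'d \<Rightarrow> real" where
  "cell_vol Y = 2 ^ CARD('d) * (\<Prod>\<alpha>\<in>UNIV. Y $ \<alpha>)"

definition periodic :: "real^'d \<Rightarrow> (real^'d \<Rightarrow> 'b) \<Rightarrow> bool" where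
  "periodic Y f \<longleftrightarrow> (\<forall>x \<alpha>. f (x + axis \<alpha> (2 * Y $ \<alpha>)) = f x)"

definition C0_per :: "real^'d \<Rightarrow> (real^'d \<Rightarrow> 'b::topological_space) set" where
  "C0_per Y = {f. periodic Y f \<and> continuous_on UNIV f}"

text \<open>Elements are functions rather than classes modulo null sets.\<close>

definition L2_per :: "real^'d \<Rightarrow> (real^'d \<Rightarrow> 'b::euclidean_space) set" where
  "L2_per Y = {u. periodic Y u \<and> u \<in> borel_measurable lebesgue \<and>
     (\<forall>K. compact K \<longrightarrow> set_integrable lebesgue K (\<lambda>x. (norm (u x))\<^sup>2))}"

definition partial :: "'d \<Rightarrow> (real^'d \<Rightarrow> real) \<Rightarrow> real^'d \<Rightarrow> real" where
  "partial \<alpha> f x = frechet_derivative f (at x) (axis \<alpha> 1)"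

primrec Ck :: "nat \<Rightarrow> (real^'d \<Rightarrow> real) \<Rightarrow> bool" where
  "Ck 0 f \<longleftrightarrow> continuous_on UNIV f"
| "Ck (Suc n) f \<longleftrightarrow> f differentiable_on UNIV \<and> (\<forall>\<alpha>. Ck n (partial \<alpha> f))"

definition smooth_per :: "real^'d \<Rightarrow> (real^'d \<Rightarrow> real) set" where
  "smooth_per Y = {f. periodic Y f \<and> (\<forall>n. Ck n f)}"

text \<open>\<open>w\<close> is a weak partial derivative of \<open>v\<close> in direction \<open>\<alpha>\<close>; it is determined
  up to a null set, so this is a relation.\<close>

definition weak_partial ::
    "real^'d \<Rightarrow> 'd \<Rightarrow> (real^'d \<Rightarrow> real) \<Rightarrow> (real^'d \<Rightarrow> real) \<Rightarrow> bool" where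
  "weak_partial Y \<alpha> v w \<longleftrightarrow> v \<in> L2_per Y \<and> w \<in> L2_per Y \<and>
     (\<forall>\<phi>\<in>smooth_per Y.
        (LINT x:cell Y|lebesgue. v x * partial \<alpha> \<phi> x) = - (LINT x:cell Y|lebesgue. w x * \<phi> x))"

definition H1_per :: "real^'d \<Rightarrow> (real^'d \<Rightarrow> real) set" where
  "H1_per Y = {v \<in> L2_per Y. \<forall>\<alpha>. \<exists>w. weak_partial Y \<alpha> v w}"

definition curl_free :: "real^'d \<Rightarrow> (real^'d \<Rightarrow> real^'d) \<Rightarrow> bool" where
  "curl_free Y u \<longleftrightarrow> (\<forall>\<alpha> \<beta>. \<forall>v\<in>H1_per Y. \<forall>v\<alpha> v\<beta>.
     weak_partial Y \<alpha> v v\<alpha> \<longrightarrow> weak_partial Y \<beta> v v\<beta> \<longrightarrow>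
     (LINT x:cell Y|lebesgue. u x $ \<alpha> * v\<beta> x - u x $ \<beta> * v\<alpha> x) = 0)"

definition E_space :: "real^'d \<Rightarrow> (real^'d \<Rightarrow> real^'d) set" where
  "E_space Y = {u \<in> L2_per Y. curl_free Y u \<and> (LINT x:cell Y|lebesgue. u x) = 0}"

abbreviation cvec :: "real^'d \<Rightarrow> complex^'d" where
  "cvec v \<equiv> (\<chi> i. complex_of_real (v $ i))"

definition L2_inner :: "real^'d \<Rightarrow> (real^'d \<Rightarrow> complex^'d) \<Rightarrow> (real^'d \<Rightarrow> complex^'d) \<Rightarrow> complex" where
  "L2_inner Y u v =
     (LINT x:cell Y|lebesgue. \<Sum>i\<in>UNIV. u x $ i * cnj (v x $ i)) / of_real (cell_vol Y)"

definition xi :: "real^'d \<Rightarrow> int^'d \<Rightarrow> real^'d" where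
  "xi Y k = (\<chi> \<alpha>. of_int (k $ \<alpha>) / Y $ \<alpha>)"

definition fourier_mode :: "real^'d \<Rightarrow> int^'d \<Rightarrow> real^'d \<Rightarrow> complex" where
  "fourier_mode Y k x = exp (\<i> * of_real (pi * (xi Y k \<bullet> x)))"

definition ZN :: "nat^'d \<Rightarrow> (int^'d) set" where
  "ZN N = {m. \<forall>\<alpha>. - real (N $ \<alpha>) / 2 \<le> of_int (m $ \<alpha>) \<and> of_int (m $ \<alpha>) < real (N $ \<alpha>) / 2}"

definition Ntot :: "nat^'d \<Rightarrow> nat" where
  "Ntot N = (\<Prod>\<alpha>\<in>UNIV. N $ \<alpha>)"

definition grid :: "real^'d \<Rightarrow> nat^'d \<Rightarrow> int^'d \<Rightarrow> real^'d" where
  "grid Y N k = (\<chi> \<alpha>. of_int (k $ \<alpha>) * (2 * Y $ \<alpha> / real (N $ \<alpha>)))"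

definition trig_polys :: "real^'d \<Rightarrow> nat^'d \<Rightarrow> (real^'d \<Rightarrow> real^'d) set" where
  "trig_polys Y N = {u. \<exists>c :: int^'d \<Rightarrow> complex^'d.
     (\<forall>k\<in>ZN N. \<forall>i. c k $ i = cnj (c (- k) $ i)) \<and>
     (\<forall>x. cvec (u x) = (\<Sum>k\<in>ZN N. fourier_mode Y k x *s c k))}"

definition EN_space :: "real^'d \<Rightarrow> nat^'d \<Rightarrow> (real^'d \<Rightarrow> real^'d) set" where
  "EN_space Y N = E_space Y \<inter> trig_polys Y N"

definition shape_fun :: "real^'d \<Rightarrow> nat^'d \<Rightarrow> int^'d \<Rightarrow> real^'d \<Rightarrow> complex" where
  "shape_fun Y N k x = (1 / of_nat (Ntot N)) *
     (\<Sum>m\<in>ZN N. exp (\<i> * of_real (pi * (\<Sum>\<alpha>\<in>UNIV. of_int (m $ \<alpha>) *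
        (x $ \<alpha> / Y $ \<alpha> - 2 * of_int (k $ \<alpha>) / real (N $ \<alpha>))))))"

text \<open>The interpolant is built from complex exponentials, hence typed as complex-valued;
  its values are real when all entries of \<open>N\<close> are odd.\<close>

definition interp :: "real^'d \<Rightarrow> nat^'d \<Rightarrow> (real^'d \<Rightarrow> real^'d) \<Rightarrow> real^'d \<Rightarrow> complex^'d" where
  "interp Y N u x = (\<Sum>k\<in>ZN N. shape_fun Y N k x *s cvec (u (grid Y N k)))"

text \<open>A structured vector is a function on all multi-indices that vanishes outside \<open>ZN N\<close>.
  Only the blocks of a structured matrix with both indices in \<open>ZN N\<close> are relevant.\<close>

type_synonym ('a, 'd) svec = "int^'d \<Rightarrow> 'a^'d"
type_synonym ('a, 'd) smat = "int^'d \<Rightarrow> int^'d \<Rightarrow> 'a^'d^'d"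

definition svecs :: "nat^'d \<Rightarrow> (real, 'd::finite) svec set" where
  "svecs N = {v. \<forall>k. k \<notin> ZN N \<longrightarrow> v k = 0}"

definition svec_inner :: "nat^'d \<Rightarrow> (real, 'd::finite) svec \<Rightarrow> (real, 'd) svec \<Rightarrow> real" where
  "svec_inner N u v = (1 / real (Ntot N)) * (\<Sum>k\<in>ZN N. u k \<bullet> v k)"

definition smat_app ::
    "nat^'d \<Rightarrow> ('a::comm_ring_1, 'd::finite) smat \<Rightarrow> ('a, 'd) svec \<Rightarrow> ('a, 'd) svec" where
  "smat_app N M v = (\<lambda>k. if k \<in> ZN N then \<Sum>m\<in>ZN N. M k m *v v m else 0)"

definition smat_mult ::
    "nat^'d \<Rightarrow> ('a::comm_ring_1, 'd::finite) smat \<Rightarrow> ('a, 'd) smat \<Rightarrow> ('a, 'd) smat" where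
  "smat_mult N L M = (\<lambda>k m. \<Sum>j\<in>ZN N. L k j ** M j m)"

definition smat_diag :: "(int^'d \<Rightarrow> 'a^'d^'d) \<Rightarrow> ('a::comm_ring_1, 'd::finite) smat" where
  "smat_diag B = (\<lambda>k m. if k = m then B k else 0)"

definition smat_id :: "('a::comm_ring_1, 'd::finite) smat" where
  "smat_id = smat_diag (\<lambda>k. mat 1)"

definition csvec :: "(real, 'd::finite) svec \<Rightarrow> (complex, 'd) svec" where
  "csvec v = (\<lambda>k. cvec (v k))"

definition csmat :: "(real, 'd::finite) smat \<Rightarrow> (complex, 'd) smat" where
  "csmat M = (\<lambda>k m. map_matrix complex_of_real (M k m))"

definition sample :: "real^'d \<Rightarrow> nat^'d \<Rightarrow> (real^'d \<Rightarrow> real^'d) \<Rightarrow> (real, 'd::finite) svec" where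
  "sample Y N u = (\<lambda>k. if k \<in> ZN N then u (grid Y N k) else 0)"

definition EEN :: "real^'d \<Rightarrow> nat^'d \<Rightarrow> (real, 'd::finite) svec set" where
  "EEN Y N = sample Y N ` EN_space Y N"

definition A_mat :: "real^'d \<Rightarrow> nat^'d \<Rightarrow> (real^'d \<Rightarrow> real^'d^'d) \<Rightarrow> (real, 'd::finite) smat" where
  "A_mat Y N A = smat_diag (\<lambda>k. A (grid Y N k))"

definition A0_mat :: "real^'d^'d \<Rightarrow> (real, 'd::finite) smat" where
  "A0_mat A0 = smat_diag (\<lambda>k. A0)"

definition E_vec :: "nat^'d \<Rightarrow> real^'d \<Rightarrow> (real, 'd::finite) svec" where
  "E_vec N E = (\<lambda>k. if k \<in> ZN N then E else 0)"

definition Gamma_hat :: "real^'d \<Rightarrow> real^'d^'d \<Rightarrow> int^'d \<Rightarrow> real^'d^'d" where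
  "Gamma_hat Y A0 k = (if k = 0 then 0
     else (1 / ((A0 *v xi Y k) \<bullet> xi Y k)) *\<^sub>R (\<chi> i j. xi Y k $ i * xi Y k $ j))"

definition omega :: "nat^'d \<Rightarrow> int^'d \<Rightarrow> int^'d \<Rightarrow> complex" where
  "omega N k m =
     exp (2 * of_real pi * \<i> * of_real (\<Sum>\<alpha>\<in>UNIV. of_int (k $ \<alpha>) * of_int (m $ \<alpha>) / real (N $ \<alpha>)))"

definition DFT :: "nat^'d \<Rightarrow> (complex, 'd::finite) smat" where
  "DFT N = (\<lambda>k m. mat (1 / of_nat (Ntot N) * omega N (- k) m))"

definition iDFT :: "nat^'d \<Rightarrow> (complex, 'd::finite) smat" where
  "iDFT N = (\<lambda>k m. mat (omega N k m))"

definition Gamma0 :: "real^'d \<Rightarrow> nat^'d \<Rightarrow> real^'d^'d \<Rightarrow> (complex, 'd::finite) smat" where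
  "Gamma0 Y N A0 =
     smat_mult N (smat_mult N (iDFT N) (csmat (smat_diag (Gamma_hat Y A0)))) (DFT N)"

definition G0_mat :: "real^'d \<Rightarrow> nat^'d \<Rightarrow> real^'d^'d \<Rightarrow> (complex, 'd::finite) smat" where
  "G0_mat Y N A0 = smat_mult N (Gamma0 Y N A0) (csmat (A0_mat A0))"

definition G_mat :: "real^'d \<Rightarrow> nat^'d \<Rightarrow> (complex, 'd::finite) smat" where
  "G_mat Y N = G0_mat Y N (mat 1)"

definition galerkin_ni_sol ::
    "real^'d \<Rightarrow> nat^'d \<Rightarrow> (real^'d \<Rightarrow> real^'d^'d) \<Rightarrow> real^'d \<Rightarrow> (real^'d \<Rightarrow> real^'d) \<Rightarrow> bool" where
  "galerkin_ni_sol Y N A E u \<longleftrightarrow> u \<in> EN_space Y N \<and>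
     (\<forall>v\<in>EN_space Y N.
        L2_inner Y (interp Y N (\<lambda>x. A x *v u x)) (\<lambda>x. cvec (v x)) =
        - L2_inner Y (interp Y N (\<lambda>x. A x *v E)) (\<lambda>x. cvec (v x)))"

definition discrete_sol ::
    "real^'d \<Rightarrow> nat^'d \<Rightarrow> (real^'d \<Rightarrow> real^'d^'d) \<Rightarrow> real^'d \<Rightarrow> (real, 'd::finite) svec \<Rightarrow> bool" where
  "discrete_sol Y N A E e \<longleftrightarrow> e \<in> EEN Y N \<and>
     (\<forall>v\<in>EEN Y N.
        svec_inner N (smat_app N (A_mat Y N A) e) v =
        - svec_inner N (smat_app N (A_mat Y N A) (E_vec N E)) v)"

definition lippmann_schwinger_sol ::
    "real^'d \<Rightarrow> nat^'d \<Rightarrow> (real^'d \<Rightarrow> real^'d^'d) \<Rightarrow> real^'d^'d \<Rightarrow> real^'d \<Rightarrow>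
     (real, 'd::finite) svec \<Rightarrow> bool" where
  "lippmann_schwinger_sol Y N A A0 E e \<longleftrightarrow> e \<in> svecs N \<and>
     smat_app N (smat_id + smat_mult N (Gamma0 Y N A0) (csmat (A_mat Y N A - A0_mat A0))) (csvec e)
       = csvec (E_vec N E)"

end

theory Submission
  imports Defs
begin

text \<open>A real trigonometric polynomial belongs to \<open>E_space\<close> iff its zeroth Fourier coefficient vanishes and
  every other coefficient is parallel to its frequency; necessity follows by testing the curl with single
  modes, sufficiency by integrating by parts. Sampling turns Fourier coefficients into
  discrete ones, and the \<open>L\<^sup>2\<close> product of an interpolant with a compatible
  polynomial into the discrete scalar product, so the Galerkin problem with numerical integration and
  the discrete problem coincide. The discrete Green operator \<open>\<Gamma>\<close> of \<open>A0\<close> is symmetric, has values in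
  the sampled space \<open>EEN\<close>, satisfies \<open>\<Gamma> A0 w = w\<close> there and \<open>\<Gamma> A0 E = 0\<close> on constants. Hence
  \<open>(f, v) = (f, \<Gamma> A0 v) = (\<Gamma> f, A0 v)\<close> for \<open>v\<close> in \<open>EEN\<close>, so that \<open>f\<close> is orthogonal to \<open>EEN\<close> iff
  \<open>\<Gamma> f = 0\<close>. With \<open>f = A (E + e)\<close> this gives the discrete problem, the Lippmann--Schwinger equation
  and the projected linear system at once.\<close>

section \<open>Structured matrices and the discrete Fourier transform\<close>

text \<open>Oddness of \<open>N\<close> makes \<open>ZN N\<close> invariant under negation, so every
  frequency is paired with its opposite: conjugate symmetry of coefficients then means real values,
  and no unpaired highest frequency disturbs the passage between coefficients and samples. The
  complex matrix \<open>Gamma0\<close> can thus be replaced by a real operator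
  \<open>green_op\<close>, built as the sample of a polynomial so that its range lies in
  \<open>EEN\<close> by construction. The criterion \<Gamma> f = 0 characterizes the same
  orthogonality for every positive definite reference, which is why \<open>A0\<close> and the
  identity lead to one discrete problem. Solvability is proved only for that problem, by projection
  in the energy product of \<open>A\<close>, and then transferred to the Lippmann--Schwinger
  equation, so no operator is inverted. The bounds on \<open>A\<close> hold only almost everywhere,
  whereas the grid is a null set. Continuity of \<open>A\<close>, together with the fact that the
  grid stays in the interior of the cell, closes this gap.\<close>

lemma sum_matrix_vector_mult:
  fixes f :: "'i \<Rightarrow> 'a::comm_ring_1^'m^'n"
  shows "(\<Sum>j\<in>J. f j) *v x = (\<Sum>j\<in>J. f j *v x)"
  by (induction J rule: infinite_finite_induct) (simp_all add: matrix_vector_mult_add_rdistrib)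

lemma matrix_vector_mult_sum_right:
  fixes M :: "'a::comm_ring_1^'m^'n"
  shows "M *v (\<Sum>j\<in>J. f j) = (\<Sum>j\<in>J. M *v f j)"
  by (induction J rule: infinite_finite_induct) (simp_all add: matrix_vector_right_distrib)

lemma smat_app_mult:
  "smat_app N (smat_mult N L M) v = smat_app N L (smat_app N M v)"
proof
  fix k
  have "(\<Sum>m\<in>ZN N. \<Sum>j\<in>ZN N. L k j *v (M j m *v v m))
      = (\<Sum>j\<in>ZN N. \<Sum>m\<in>ZN N. L k j *v (M j m *v v m))"
    by (rule sum.swap)
  then show "smat_app N (smat_mult N L M) v k = smat_app N L (smat_app N M v) k"
    by (simp add: smat_app_def smat_mult_def sum_matrix_vector_mult matrix_vector_mul_assoc[symmetric]
        matrix_vector_mult_sum_right)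
qed

text \<open>Half of an odd number is not an integer, so the weak lower and the strict upper bound
  cut off symmetrically. Closure of \<open>ZN N\<close> under negation rests on this.\<close>

lemma ZN_iff:
  fixes N :: "nat^'d::finite"
  assumes "\<forall>\<alpha>. odd (N $ \<alpha>)"
  shows "m \<in> ZN N \<longleftrightarrow> (\<forall>\<alpha>. m $ \<alpha> \<in> {- int (N $ \<alpha> div 2)..int (N $ \<alpha> div 2)})"
proof -
  have "(- real (N $ \<alpha>) / 2 \<le> of_int (m $ \<alpha>) \<and> of_int (m $ \<alpha>) < real (N $ \<alpha>) / 2)
      \<longleftrightarrow> m $ \<alpha> \<in> {- int (N $ \<alpha> div 2)..int (N $ \<alpha> div 2)}" for \<alpha>
  proof -
    have "(- real (N $ \<alpha>) / 2 \<le> of_int (m $ \<alpha>) \<and> of_int (m $ \<alpha>) < real (N $ \<alpha>) / 2)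
      \<longleftrightarrow> - int (N $ \<alpha>) \<le> 2 * m $ \<alpha> \<and> 2 * m $ \<alpha> < int (N $ \<alpha>)"
      by linarith
    also obtain M where "N $ \<alpha> = 2 * M + 1" using assms oddE by blast
    then have "(- int (N $ \<alpha>) \<le> 2 * m $ \<alpha> \<and> 2 * m $ \<alpha> < int (N $ \<alpha>))
      \<longleftrightarrow> m $ \<alpha> \<in> {- int (N $ \<alpha> div 2)..int (N $ \<alpha> div 2)}"
      by auto
    finally show ?thesis .
  qed
  then show ?thesis by (simp add: ZN_def)
qed

lemma uminus_mem_ZN:
  assumes "\<forall>\<alpha>. odd (N $ \<alpha>)"
  shows "- m \<in> ZN N \<longleftrightarrow> m \<in> ZN N"
proof -
  have "- (m $ \<alpha>) \<in> {- int (N $ \<alpha> div 2)..int (N $ \<alpha> div 2)} \<longleftrightarrow>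
      m $ \<alpha> \<in> {- int (N $ \<alpha> div 2)..int (N $ \<alpha> div 2)}" for \<alpha>
    by auto
  then show ?thesis using assms by (simp add: ZN_iff)
qed

lemma zero_mem_ZN: "\<forall>\<alpha>. odd (N $ \<alpha>) \<Longrightarrow> 0 \<in> ZN N"
  by (simp add: ZN_iff)

lemma ZN_eq_image:
  fixes N :: "nat^'d::finite"
  assumes "\<forall>\<alpha>. odd (N $ \<alpha>)"
  shows "ZN N = vec_lambda ` PiE UNIV (\<lambda>\<alpha>. {- int (N $ \<alpha> div 2)..int (N $ \<alpha> div 2)})"
proof (intro equalityI subsetI)
  fix m assume "m \<in> ZN N"
  then have "vec_nth m \<in> PiE UNIV (\<lambda>\<alpha>. {- int (N $ \<alpha> div 2)..int (N $ \<alpha> div 2)})"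
    using assms by (simp add: ZN_iff PiE_UNIV_domain)
  then show "m \<in> vec_lambda ` PiE UNIV (\<lambda>\<alpha>. {- int (N $ \<alpha> div 2)..int (N $ \<alpha> div 2)})"
    by (rule image_eqI[rotated]) simp
qed (use assms in \<open>auto simp: ZN_iff PiE_UNIV_domain\<close>)

lemma finite_ZN:
  fixes N :: "nat^'d::finite"
  assumes "\<forall>\<alpha>. odd (N $ \<alpha>)"
  shows "finite (ZN N)"
  by (simp add: ZN_eq_image[OF assms] finite_PiE)

lemma sum_prod_ZN:
  fixes N :: "nat^'d::finite" and f :: "'d \<Rightarrow> int \<Rightarrow> 'a::comm_semiring_1"
  assumes "\<forall>\<alpha>. odd (N $ \<alpha>)"
  shows "(\<Sum>m\<in>ZN N. \<Prod>\<alpha>\<in>UNIV. f \<alpha> (m $ \<alpha>))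
    = (\<Prod>\<alpha>\<in>UNIV. \<Sum>i\<in>{- int (N $ \<alpha> div 2)..int (N $ \<alpha> div 2)}. f \<alpha> i)"
  unfolding ZN_eq_image[OF assms]
  by (subst sum.reindex) (auto simp: prod_sum_PiE inj_on_def vec_lambda_inject o_def)

text \<open>Shifting the index by \<open>n\<close> leaves an ordinary geometric sum over a full
  period, up to the factor \<open>1 / q ^ n\<close>.\<close>

lemma sum_geometric_int_interval:
  fixes q :: "'a::field"
  assumes "q ^ (2 * n + 1) = 1" and "q \<noteq> 1"
  shows "(\<Sum>i\<in>{- int n..int n}. q powi i) = 0"
proof -
  have [simp]: "q \<noteq> 0" using assms(1) by auto
  have "(\<Sum>i\<in>{- int n..int n}. q powi i) = (\<Sum>i<2 * n + 1. q powi (int i - int n))"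
    by (rule sum.reindex_bij_witness[of _ "\<lambda>i. int i - int n" "\<lambda>i. nat (i + int n)"]) auto
  also have "\<dots> = (\<Sum>i<2 * n + 1. q ^ i) / q ^ n"
    by (simp add: power_int_diff sum_divide_distrib del: sum.lessThan_Suc)
  also have "(\<Sum>i<2 * n + 1. q ^ i) = 0"
    using assms geometric_sum[of q "2 * n + 1"] by simp
  finally show ?thesis by simp
qed

lemma omega_eq_prod:
  "omega N k m = (\<Prod>\<alpha>\<in>UNIV. exp (2 * of_real pi * \<i> * of_int (k $ \<alpha>) / of_nat (N $ \<alpha>)) powi (m $ \<alpha>))"
proof -
  have "2 * of_real pi * \<i> * of_real (\<Sum>\<alpha>\<in>UNIV. of_int (k $ \<alpha>) * of_int (m $ \<alpha>) / real (N $ \<alpha>))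
    = (\<Sum>\<alpha>\<in>UNIV. of_int (m $ \<alpha>) * (2 * of_real pi * \<i> * of_int (k $ \<alpha>) / of_nat (N $ \<alpha>)))"
    unfolding of_real_sum sum_distrib_left by (intro sum.cong refl) simp
  then show ?thesis by (simp only: omega_def exp_power_int exp_sum finite_class.finite_UNIV)
qed

lemma omega_commute: "omega N k m = omega N m k"
  by (simp add: omega_def mult.commute)

lemma omega_add: "omega N (k + l) m = omega N k m * omega N l m"
  by (simp add: omega_def exp_add[symmetric] sum.distrib distrib_left distrib_right add_divide_distrib)

lemma omega_uminus: "omega N (- k) m = cnj (omega N k m)"
  by (simp add: omega_def exp_cnj sum_negf)

text \<open>Orthogonality of characters. In a direction with \<open>j $ \<alpha> \<noteq> 0\<close>
  the factor is a full period sum of a root of unity, and the bound on \<open>j\<close> ensures that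
  this root is not 1, since it excludes nonzero multiples of \<open>N $ \<alpha>\<close>.
  Differences of two indices in \<open>ZN N\<close> satisfy the bound.\<close>

lemma sum_omega:
  fixes N :: "nat^'d::finite"
  assumes "\<forall>\<alpha>. odd (N $ \<alpha>)" and "\<forall>\<alpha>. \<bar>j $ \<alpha>\<bar> < int (N $ \<alpha>)"
  shows "(\<Sum>m\<in>ZN N. omega N j m) = (if j = 0 then of_nat (Ntot N) else 0)"
proof -
  define q where "q \<alpha> = exp (2 * of_real pi * \<i> * of_int (j $ \<alpha>) / of_nat (N $ \<alpha>))" for \<alpha>
  have N: "N $ \<alpha> = 2 * (N $ \<alpha> div 2) + 1" for \<alpha>
    using assms(1) by (metis odd_two_times_div_two_succ)
  have "(\<Sum>m\<in>ZN N. omega N j m)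
      = (\<Prod>\<alpha>\<in>UNIV. \<Sum>i\<in>{- int (N $ \<alpha> div 2)..int (N $ \<alpha> div 2)}. q \<alpha> powi i)"
    unfolding omega_eq_prod q_def using sum_prod_ZN[OF assms(1)] .
  also have "\<dots> = (if j = 0 then of_nat (Ntot N) else 0)"
  proof (cases "j = 0")
    case True
    have "2 * of_nat (N $ \<alpha> div 2) + 1 = (of_nat (N $ \<alpha>) :: complex)" for \<alpha>
      by (subst (2) N) simp
    then have "(\<Sum>i\<in>{- int (N $ \<alpha> div 2)..int (N $ \<alpha> div 2)}. q \<alpha> powi i) = of_nat (N $ \<alpha>)" for \<alpha>
      using True by (simp add: q_def)
    then show ?thesis using True by (simp add: Ntot_def)
  next
    case False
    then obtain \<alpha> where \<alpha>: "j $ \<alpha> \<noteq> 0" by (auto simp: vec_eq_iff)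
    have N0: "N $ \<alpha> \<noteq> 0" using N[of \<alpha>] by linarith
    have "q \<alpha> ^ (N $ \<alpha>) = exp (of_nat (N $ \<alpha>) * (2 * of_real pi * \<i> * of_int (j $ \<alpha>) / of_nat (N $ \<alpha>)))"
      unfolding q_def by (rule exp_of_nat_mult[symmetric])
    also have "\<dots> = exp (2 * of_int (j $ \<alpha>) * of_real pi * \<i>)"
      using N0 by (simp add: field_simps)
    also have "\<dots> = 1" by (auto simp: exp_eq_1)
    finally have "q \<alpha> ^ (2 * (N $ \<alpha> div 2) + 1) = 1" using N[of \<alpha>] by simp
    moreover have "q \<alpha> \<noteq> 1"
    proof
      assume "q \<alpha> = 1"
      then obtain n :: int where "2 * pi * of_int (j $ \<alpha>) / of_nat (N $ \<alpha>) = of_int (2 * n) * pi"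
        by (auto simp: q_def exp_eq_1)
      then have "real_of_int (j $ \<alpha>) = real_of_int (n * int (N $ \<alpha>))"
        using N0 by (simp add: field_simps)
      then have "j $ \<alpha> = n * int (N $ \<alpha>)" by linarith
      with \<alpha> assms(2) show False
        by (metis dvd_imp_le_int dvd_triv_right abs_of_nat linorder_not_less)
    qed
    ultimately have "(\<Sum>i\<in>{- int (N $ \<alpha> div 2)..int (N $ \<alpha> div 2)}. q \<alpha> powi i) = 0"
      by (rule sum_geometric_int_interval)
    then show ?thesis using False by (simp add: prod_zero_iff) blast
  qed
  finally show ?thesis .
qed

lemma Ntot_pos: "\<forall>\<alpha>. odd (N $ \<alpha>) \<Longrightarrow> 0 < Ntot N"
  by (auto simp: Ntot_def intro!: prod_pos odd_pos)

lemma mat_vector_mult: "mat (c::'a::comm_ring_1) *v x = c *s x"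
  by (simp add: vec_eq_iff matrix_vector_mult_def mat_def if_distrib if_distribR cong: if_cong)

lemma smat_app_DFT_nth:
  "smat_app N (DFT N) v k $ i =
     (if k \<in> ZN N then (\<Sum>m\<in>ZN N. omega N (- k) m * v m $ i) / of_nat (Ntot N) else 0)"
  by (simp add: smat_app_def DFT_def mat_vector_mult sum_divide_distrib)

lemma smat_app_iDFT_nth:
  "smat_app N (iDFT N) v k $ i = (if k \<in> ZN N then \<Sum>m\<in>ZN N. omega N k m * v m $ i else 0)"
  by (simp add: smat_app_def iDFT_def mat_vector_mult)

lemma smat_app_diag:
  fixes N :: "nat^'d::finite"
  assumes "\<forall>\<alpha>. odd (N $ \<alpha>)"
  shows "smat_app N (smat_diag B) v = (\<lambda>k. if k \<in> ZN N then B k *v v k else 0)"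
  using finite_ZN[OF assms]
  by (simp add: fun_eq_iff smat_app_def smat_diag_def if_distribR if_distrib[of "\<lambda>M. M *v _"] cong: if_cong)

lemma csmat_diag: "csmat (smat_diag B) = smat_diag (\<lambda>k. map_matrix complex_of_real (B k))"
  by (auto simp: csmat_def smat_diag_def fun_eq_iff map_matrix_def vec_eq_iff)

lemma DFT_iDFT:
  fixes N :: "nat^'d::finite"
  assumes N: "\<forall>\<alpha>. odd (N $ \<alpha>)" and k: "k \<in> ZN N"
  shows "smat_app N (DFT N) (smat_app N (iDFT N) c) k = c k"
proof -
  \<comment> \<open>With \<open>N $ \<alpha>\<close> = 2M + 1 both entries lie between -M and M, so
    they differ by at most 2M, one less than the period.\<close>
  have bd: "\<bar>(j - k) $ \<alpha>\<bar> < int (N $ \<alpha>)" if "j \<in> ZN N" for j \<alpha>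
  proof -
    have "N $ \<alpha> = 2 * (N $ \<alpha> div 2) + 1" using N by (metis odd_two_times_div_two_succ)
    moreover have "j $ \<alpha> \<in> {- int (N $ \<alpha> div 2)..int (N $ \<alpha> div 2)}"
      "k $ \<alpha> \<in> {- int (N $ \<alpha> div 2)..int (N $ \<alpha> div 2)}"
      using that k by (simp_all add: ZN_iff[OF N])
    ultimately show ?thesis by auto
  qed
  have "(\<Sum>m\<in>ZN N. omega N (- k) m * (\<Sum>j\<in>ZN N. omega N m j * c j $ i)) / of_nat (Ntot N) = c k $ i" for i
  proof -
    have "(\<Sum>m\<in>ZN N. omega N (- k) m * (\<Sum>j\<in>ZN N. omega N m j * c j $ i))
        = (\<Sum>j\<in>ZN N. \<Sum>m\<in>ZN N. omega N (j - k) m * c j $ i)"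
      unfolding sum_distrib_left
      by (subst sum.swap, intro sum.cong refl)
         (simp add: omega_commute[of N _ _] flip: omega_add mult.assoc, metis add_uminus_conv_diff add.commute omega_add omega_commute mult.commute)
    also have "\<dots> = (\<Sum>j\<in>ZN N. (if j = k then of_nat (Ntot N) * c j $ i else 0))"
      by (intro sum.cong refl) (use bd in \<open>simp add: sum_distrib_right[symmetric] sum_omega[OF N]\<close>)
    also have "\<dots> = of_nat (Ntot N) * c k $ i"
      using k finite_ZN[OF N] by simp
    finally show ?thesis using Ntot_pos[OF N] by simp
  qed
  then show ?thesis using k by (simp add: vec_eq_iff smat_app_DFT_nth smat_app_iDFT_nth)
qed

section \<open>Periodic functions on the cell\<close>

lemma has_integral_translate:
  fixes f :: "'a::euclidean_space \<Rightarrow> 'b::real_normed_vector"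
  assumes "(f has_integral I) (cbox (a + c) (b + c))"
  shows "((\<lambda>x. f (x + c)) has_integral I) (cbox a b)"
  using has_integral_affinity_iff[of 1 f c I "a + c" "b + c"] assms by simp

lemma continuous_integrable_cbox:
  fixes f :: "'a::euclidean_space \<Rightarrow> 'b::banach"
  assumes "continuous_on UNIV f"
  shows "f integrable_on cbox a b"
  using assms continuous_on_subset integrable_continuous by blast

lemma integral_translate:
  fixes f :: "'a::euclidean_space \<Rightarrow> 'b::banach"
  assumes "continuous_on UNIV f"
  shows "integral (cbox a b) (\<lambda>x. f (x + c)) = integral (cbox (a + c) (b + c)) f"
  using has_integral_translate[OF integrable_integral[OF continuous_integrable_cbox[OF assms]]]
  by (rule integral_unique)

text \<open>The cell enlarged by \<open>t\<close> in direction \<alpha> can be cut in two ways: the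
  cell and a slab at its top, or a slab at the bottom and the shifted cell. The two slabs are
  translates of each other by one period.\<close>

lemma integral_cell_shift:
  fixes Y :: "real^'d::finite" and f :: "real^'d \<Rightarrow> 'b::banach"
  assumes Y: "\<forall>\<alpha>. 0 < Y $ \<alpha>" and f: "f \<in> C0_per Y" and t: "0 \<le> t" "t \<le> 2 * Y $ \<alpha>"
  shows "integral (cell Y) (\<lambda>x. f (x + axis \<alpha> t)) = integral (cell Y) f"
proof -
  have cont: "continuous_on UNIV f" and per: "f (x + axis \<alpha> (2 * Y $ \<alpha>)) = f x" for x
    using f by (auto simp: C0_per_def periodic_def)
  define e where "e = (axis \<alpha> t :: real^'d)"
  define B where "B = cbox (- Y) (Y + e)"
  note int = continuous_integrable_cbox[OF cont]
  have ax: "axis \<alpha> 1 \<in> (Basis :: (real^'d) set)" by (auto simp: Basis_vec_def)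
  have split: "integral B f = integral (B \<inter> {x. x $ \<alpha> \<le> s}) f + integral (B \<inter> {x. x $ \<alpha> \<ge> s}) f" for s
    using integral_split[OF int ax, of "- Y" "Y + e" s] by (simp add: B_def inner_axis)
  have e: "e $ i = (if i = \<alpha> then t else 0)" for i by (simp add: e_def axis_def)
  have pos: "0 < Y $ i" for i using Y by simp
  have 1: "B \<inter> {x. x $ \<alpha> \<le> Y $ \<alpha>} = cell Y"
  proof (intro set_eqI iffI)
    fix x assume x: "x \<in> B \<inter> {x. x $ \<alpha> \<le> Y $ \<alpha>}"
    have "- Y $ i \<le> x $ i \<and> x $ i \<le> Y $ i" for i
      using x by (cases "i = \<alpha>") (auto simp: B_def mem_box_cart e dest: spec[of _ i])
    then show "x \<in> cell Y" by (simp add: cell_def mem_box_cart)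
  qed (use t(1) in \<open>auto simp: B_def cell_def mem_box_cart e add_increasing2\<close>)
  have 2: "B \<inter> {x. x $ \<alpha> \<ge> t - Y $ \<alpha>} = cbox (- Y + e) (Y + e)"
  proof (intro set_eqI iffI)
    fix x assume x: "x \<in> B \<inter> {x. x $ \<alpha> \<ge> t - Y $ \<alpha>}"
    have "- Y $ i + e $ i \<le> x $ i \<and> x $ i \<le> Y $ i + e $ i" for i
      using x by (cases "i = \<alpha>") (auto simp: B_def mem_box_cart e dest: spec[of _ i])
    then show "x \<in> cbox (- Y + e) (Y + e)" by (simp add: mem_box_cart)
  next
    fix x assume x: "x \<in> cbox (- Y + e) (Y + e)"
    have "- Y $ i \<le> x $ i \<and> x $ i \<le> Y $ i + e $ i" for i
      using x t(1) by (cases "i = \<alpha>") (auto simp: mem_box_cart e dest: spec[of _ i])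
    moreover have "t - Y $ \<alpha> \<le> x $ \<alpha>"
      using x by (auto simp: mem_box_cart e dest: spec[of _ \<alpha>])
    ultimately show "x \<in> B \<inter> {x. x $ \<alpha> \<ge> t - Y $ \<alpha>}" by (simp add: B_def mem_box_cart)
  qed
  \<comment> \<open>\<open>p\<close> is one period, and \<open>Y'\<close> is the upper corner of the
    bottom slab of thickness \<open>t\<close>.\<close>
  define p where "p = (axis \<alpha> (2 * Y $ \<alpha>) :: real^'d)"
  define Y' where "Y' = (\<chi> i. if i = \<alpha> then t - Y $ \<alpha> else Y $ i)"
  have p: "p $ i = (if i = \<alpha> then 2 * Y $ \<alpha> else 0)" for i by (simp add: p_def axis_def)
  have 3: "B \<inter> {x. x $ \<alpha> \<le> t - Y $ \<alpha>} = cbox (- Y) Y'"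
  proof (intro set_eqI iffI)
    fix x assume x: "x \<in> B \<inter> {x. x $ \<alpha> \<le> t - Y $ \<alpha>}"
    have "- Y $ i \<le> x $ i \<and> x $ i \<le> Y' $ i" for i
      using x by (cases "i = \<alpha>") (auto simp: B_def Y'_def mem_box_cart e dest: spec[of _ i])
    then show "x \<in> cbox (- Y) Y'" by (simp add: mem_box_cart)
  next
    fix x assume x: "x \<in> cbox (- Y) Y'"
    have "- Y $ i \<le> x $ i \<and> x $ i \<le> Y $ i + e $ i" for i
      using x t pos[of i] by (cases "i = \<alpha>") (auto simp: mem_box_cart Y'_def e dest: spec[of _ i])
    moreover have "x $ \<alpha> \<le> t - Y $ \<alpha>"
      using x by (auto simp: mem_box_cart Y'_def dest: spec[of _ \<alpha>])
    ultimately show "x \<in> B \<inter> {x. x $ \<alpha> \<le> t - Y $ \<alpha>}" by (simp add: B_def mem_box_cart)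
  qed
  have 4: "B \<inter> {x. x $ \<alpha> \<ge> Y $ \<alpha>} = cbox (- Y + p) (Y' + p)"
  proof (intro set_eqI iffI)
    fix x assume x: "x \<in> B \<inter> {x. x $ \<alpha> \<ge> Y $ \<alpha>}"
    have "- Y $ i + p $ i \<le> x $ i \<and> x $ i \<le> Y' $ i + p $ i" for i
      using x by (cases "i = \<alpha>") (auto simp: B_def Y'_def mem_box_cart e p dest: spec[of _ i])
    then show "x \<in> cbox (- Y + p) (Y' + p)" by (simp add: mem_box_cart)
  next
    fix x assume x: "x \<in> cbox (- Y + p) (Y' + p)"
    have "- Y $ i \<le> x $ i \<and> x $ i \<le> Y $ i + e $ i" for i
      using x t pos[of i] by (cases "i = \<alpha>") (auto simp: mem_box_cart Y'_def e p dest: spec[of _ i])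
    moreover have "Y $ \<alpha> \<le> x $ \<alpha>"
      using x by (auto simp: mem_box_cart p dest: spec[of _ \<alpha>])
    ultimately show "x \<in> B \<inter> {x. x $ \<alpha> \<ge> Y $ \<alpha>}" by (simp add: B_def mem_box_cart)
  qed
  have "integral (cbox (- Y + p) (Y' + p)) f = integral (cbox (- Y) Y') f"
    using integral_translate[OF cont, of "- Y" Y' p] per by (simp add: p_def)
  moreover have "integral (cell Y) (\<lambda>x. f (x + axis \<alpha> t)) = integral (cbox (- Y + e) (Y + e)) f"
    using integral_translate[OF cont, of "- Y" Y e] by (simp add: e_def cell_def)
  ultimately show ?thesis
    using split[of "Y $ \<alpha>"] split[of "t - Y $ \<alpha>"] by (simp add: 1 2 3 4)
qed

lemma frechet_derivative_translate:
  fixes f :: "'a::real_normed_vector \<Rightarrow> 'b::real_normed_vector"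
  assumes "f differentiable (at (x + c))"
  shows "frechet_derivative (\<lambda>y. f (y + c)) (at x) = frechet_derivative f (at (x + c))"
proof -
  have "(f has_derivative frechet_derivative f (at (x + c))) (at (x + c))"
    using assms frechet_derivative_works by blast
  moreover have "((\<lambda>y. y + c) has_derivative (\<lambda>h. h)) (at x)"
    by (auto intro!: derivative_eq_intros)
  ultimately have "((\<lambda>y. f (y + c)) has_derivative frechet_derivative f (at (x + c))) (at x)"
    using has_derivative_compose[of "\<lambda>y. y + c" "\<lambda>h. h" x UNIV f] by simp
  then show ?thesis using frechet_derivative_at by metis
qed

lemma periodic_partial:
  assumes "periodic Y f" and "f differentiable_on UNIV"
  shows "periodic Y (partial \<alpha> f)"
  unfolding periodic_def
proof (intro allI)
  fix x \<beta>
  have "f differentiable (at (x + axis \<beta> (2 * Y $ \<beta>)))"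
    using assms(2) by (simp add: differentiable_on_def)
  from frechet_derivative_translate[OF this]
  show "partial \<alpha> f (x + axis \<beta> (2 * Y $ \<beta>)) = partial \<alpha> f x"
    using assms(1) by (simp add: partial_def periodic_def)
qed

text \<open>Instead of slicing the cell along \<alpha>, the derivative is averaged over all
  translations by \<open>s\<close> in one period. Integrating over \<open>s\<close> first gives 0 by
  the fundamental theorem and periodicity; integrating over the cell first gives the length of the
  period times the wanted integral, by shift invariance.\<close>

lemma integral_partial_periodic:
  fixes Y :: "real^'d::finite"
  assumes Y: "\<forall>\<alpha>. 0 < Y $ \<alpha>" and f: "periodic Y f" "f differentiable_on UNIV"
    and cont: "continuous_on UNIV (partial \<alpha> f)"
  shows "integral (cell Y) (partial \<alpha> f) = 0"
proof -
  define T where "T = 2 * Y $ \<alpha>"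
  have T: "0 < T" using Y by (simp add: T_def)
  have ax: "axis \<alpha> s = s *\<^sub>R (axis \<alpha> 1 :: real^'d)" for s
    by (simp add: vec_eq_iff axis_def)
  have zero: "integral (cbox 0 T) (\<lambda>s. partial \<alpha> f (x + axis \<alpha> s)) = 0" for x
  proof -
    have "((\<lambda>s. partial \<alpha> f (x + axis \<alpha> s)) has_integral f (x + axis \<alpha> T) - f (x + axis \<alpha> 0)) {0..T}"
    proof (rule fundamental_theorem_of_calculus)
      fix s
      let ?D = "frechet_derivative f (at (x + axis \<alpha> s))"
      have D: "(f has_derivative ?D) (at (x + axis \<alpha> s))"
        using f(2) frechet_derivative_works by (auto simp: differentiable_on_def)
      have "((\<lambda>s. x + s *\<^sub>R axis \<alpha> 1) has_vector_derivative axis \<alpha> 1) (at s within {0..T})"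
        by (auto intro!: derivative_eq_intros)
      then have "((\<lambda>s. x + axis \<alpha> s) has_vector_derivative axis \<alpha> 1) (at s within {0..T})"
        by (simp only: ax[symmetric])
      from vector_derivative_diff_chain_within[OF this has_derivative_at_withinI[OF D]]
      show "((\<lambda>s. f (x + axis \<alpha> s)) has_vector_derivative partial \<alpha> f (x + axis \<alpha> s)) (at s within {0..T})"
        by (simp add: o_def partial_def)
    qed (use T in simp)
    moreover have "f (x + axis \<alpha> T) = f x" using f(1) by (simp add: T_def periodic_def)
    moreover have "axis \<alpha> 0 = (0 :: real^'d)" by (simp add: vec_eq_iff axis_def)
    ultimately show ?thesis by (auto intro: integral_unique)
  qed
  have "continuous_on (cbox (- Y, 0) (Y, T)) (\<lambda>p. partial \<alpha> f (fst p + snd p *\<^sub>R axis \<alpha> 1))"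
    by (intro continuous_on_compose2[OF cont] continuous_intros) auto
  then have "continuous_on (cbox (- Y, 0) (Y, T)) (\<lambda>(x, s). partial \<alpha> f (x + axis \<alpha> s))"
    by (simp only: case_prod_unfold ax[symmetric])
  from integral_swap_continuous[OF this]
  have "0 = integral (cbox 0 T) (\<lambda>s. integral (cell Y) (\<lambda>x. partial \<alpha> f (x + axis \<alpha> s)))"
    by (simp add: zero[simplified] cell_def)
  also have "\<dots> = integral (cbox 0 T) (\<lambda>s. integral (cell Y) (partial \<alpha> f))"
    using periodic_partial[OF f] cont
    by (intro integral_cong integral_cell_shift[OF Y]) (auto simp: C0_per_def T_def)
  finally show ?thesis using T by simp
qed

section \<open>Integrability on the cell and weak derivatives of smooth functions\<close>

lemma C0_per_imp_L2_per:
  assumes "f \<in> C0_per Y"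
  shows "f \<in> L2_per Y"
proof -
  have cont: "continuous_on UNIV f" using assms by (simp add: C0_per_def)
  have "set_integrable lebesgue K (\<lambda>x. (norm (f x))\<^sup>2)" if K: "compact K" for K
  proof -
    obtain a b where "K \<subseteq> cbox a b" using K compact_imp_bounded bounded_subset_cbox_symmetric by metis
    moreover have "set_integrable lebesgue (cbox a b) (\<lambda>x. (norm (f x))\<^sup>2)"
      by (intro absolutely_integrable_continuous continuous_intros continuous_on_subset[OF cont]) auto
    ultimately show ?thesis
      using K by (blast intro: set_integrable_subset fmeasurableD lmeasurable_compact)
  qed
  moreover have "f \<in> borel_measurable lebesgue"
    by (rule measurable_completion) (simp add: borel_measurable_continuous_onI cont)
  ultimately show ?thesis using assms by (auto simp: L2_per_def C0_per_def)
qed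

lemma LINT_cell_continuous:
  fixes f :: "real^'d::finite \<Rightarrow> 'b::euclidean_space"
  assumes "continuous_on UNIV f"
  shows "(LINT x:cell Y|lebesgue. f x) = integral (cell Y) f"
  unfolding cell_def
  by (intro set_lebesgue_integral_eq_integral(2) absolutely_integrable_continuous
      continuous_on_subset[OF assms]) simp

text \<open>The product is dominated by the sum of the two squares. This permits splitting the curl
  integral, where the weak derivatives of the test function are merely square-integrable.\<close>

lemma set_integrable_L2_times_continuous:
  fixes g :: "real^'d::finite \<Rightarrow> real"
  assumes f: "continuous_on UNIV f" and g: "g \<in> L2_per Y"
  shows "set_integrable lebesgue (cell Y) (\<lambda>x. f x * g x)"
proof -
  have ms: "cell Y \<in> sets lebesgue" by (simp add: cell_def)
  have gm: "g \<in> borel_measurable lebesgue" using g by (simp add: L2_per_def)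
  have fm: "f \<in> borel_measurable lebesgue"
    by (rule measurable_completion) (simp add: borel_measurable_continuous_onI f)
  have "set_integrable lebesgue (cell Y) (\<lambda>x. (f x)\<^sup>2 + (norm (g x))\<^sup>2)"
  proof (rule set_integral_add(1))
    show "set_integrable lebesgue (cell Y) (\<lambda>x. (f x)\<^sup>2)"
      unfolding cell_def
      by (intro absolutely_integrable_continuous continuous_intros continuous_on_subset[OF f]) auto
    show "set_integrable lebesgue (cell Y) (\<lambda>x. (norm (g x))\<^sup>2)"
      using g by (simp add: L2_per_def cell_def)
  qed
  then show ?thesis
  proof (rule set_integrable_bound)
    show "set_borel_measurable lebesgue (cell Y) (\<lambda>x. f x * g x)"
      unfolding set_borel_measurable_def using gm fm ms by measurable
    have "norm (f x * g x) \<le> norm ((f x)\<^sup>2 + (norm (g x))\<^sup>2)" for x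
    proof -
      have "2 * (\<bar>f x\<bar> * \<bar>g x\<bar>) \<le> \<bar>f x\<bar>\<^sup>2 + \<bar>g x\<bar>\<^sup>2"
        using sum_squares_bound[of "\<bar>f x\<bar>" "\<bar>g x\<bar>"] by simp
      moreover have "0 \<le> \<bar>f x\<bar> * \<bar>g x\<bar>" by simp
      ultimately have "\<bar>f x\<bar> * \<bar>g x\<bar> \<le> \<bar>f x\<bar>\<^sup>2 + \<bar>g x\<bar>\<^sup>2" by linarith
      then show ?thesis by (simp add: abs_mult)
    qed
    then show "AE x in lebesgue. x \<in> cell Y \<longrightarrow> norm (f x * g x) \<le> norm ((f x)\<^sup>2 + (norm (g x))\<^sup>2)"
      by simp
  qed
qed

lemma smooth_perD:
  assumes "f \<in> smooth_per Y"
  shows "periodic Y f" "f differentiable_on UNIV" "continuous_on UNIV f"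
    "partial \<alpha> f \<in> smooth_per Y" "f \<in> C0_per Y"
proof -
  have Ck: "Ck n f" for n using assms by (simp add: smooth_per_def)
  show per: "periodic Y f" using assms by (simp add: smooth_per_def)
  show diff: "f differentiable_on UNIV" using Ck[of 1] by simp
  show cont: "continuous_on UNIV f" using Ck[of 0] by simp
  have "Ck n (partial \<alpha> f)" for n using Ck[of "Suc n"] by simp
  then show "partial \<alpha> f \<in> smooth_per Y"
    using periodic_partial[OF per diff] by (simp add: smooth_per_def)
  show "f \<in> C0_per Y" using per cont by (simp add: C0_per_def)
qed

lemma partial_mult:
  assumes "f differentiable_on UNIV" "g differentiable_on UNIV"
  shows "partial \<alpha> (\<lambda>x. f x * g x) = (\<lambda>x. f x * partial \<alpha> g x + partial \<alpha> f x * g x)"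
proof
  fix x
  have "(f has_derivative frechet_derivative f (at x)) (at x)"
    "(g has_derivative frechet_derivative g (at x)) (at x)"
    using assms frechet_derivative_works by (auto simp: differentiable_on_def)
  from frechet_derivative_at[OF has_derivative_mult[OF this]]
  show "partial \<alpha> (\<lambda>x. f x * g x) x = f x * partial \<alpha> g x + partial \<alpha> f x * g x"
    unfolding partial_def by metis
qed

text \<open>Integration by parts: the derivative of the periodic product \<open>f x * g x\<close>
  has integral 0. It makes smooth functions with their classical derivatives admissible in
  \<open>curl_free\<close>.\<close>

lemma weak_partial_smooth:
  fixes Y :: "real^'d::finite"
  assumes Y: "\<forall>\<alpha>. 0 < Y $ \<alpha>" and f: "f \<in> smooth_per Y"
  shows "weak_partial Y \<alpha> f (partial \<alpha> f)"
  unfolding weak_partial_def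
proof (intro conjI ballI)
  show "f \<in> L2_per Y" "partial \<alpha> f \<in> L2_per Y"
    using smooth_perD[OF f] smooth_perD(5) C0_per_imp_L2_per by blast+
  fix g assume g: "g \<in> smooth_per Y"
  note F = smooth_perD[OF f] and G = smooth_perD[OF g]
  note cont = smooth_perD(3)[OF F(4)] smooth_perD(3)[OF G(4)] F(3) G(3)
  have "integral (cell Y) (partial \<alpha> (\<lambda>x. f x * g x)) = 0"
  proof (rule integral_partial_periodic[OF Y])
    show "periodic Y (\<lambda>x. f x * g x)" using F(1) G(1) by (simp add: periodic_def)
    show "(\<lambda>x. f x * g x) differentiable_on UNIV" using F(2) G(2) by (rule differentiable_on_mult)
    show "continuous_on UNIV (partial \<alpha> (\<lambda>x. f x * g x))"
      unfolding partial_mult[OF F(2) G(2)] by (intro continuous_intros cont)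
  qed
  moreover have "integral (cell Y) (partial \<alpha> (\<lambda>x. f x * g x))
      = integral (cell Y) (\<lambda>x. f x * partial \<alpha> g x) + integral (cell Y) (\<lambda>x. partial \<alpha> f x * g x)"
    unfolding partial_mult[OF F(2) G(2)] cell_def
    by (intro integral_add continuous_integrable_cbox continuous_intros cont)
  moreover have "continuous_on UNIV (\<lambda>x. f x * partial \<alpha> g x)" "continuous_on UNIV (\<lambda>x. partial \<alpha> f x * g x)"
    by (intro continuous_intros cont)+
  ultimately show "(LINT x:cell Y|lebesgue. f x * partial \<alpha> g x) = - (LINT x:cell Y|lebesgue. partial \<alpha> f x * g x)"
    by (simp add: LINT_cell_continuous)
qed

section \<open>Trigonometric polynomials\<close>

lemma xi_inner_axis: "xi Y k \<bullet> axis \<alpha> t = of_int (k $ \<alpha>) / Y $ \<alpha> * t"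
  by (simp add: xi_def inner_axis)

lemma fourier_mode_add: "fourier_mode Y k (x + y) = fourier_mode Y k x * fourier_mode Y k y"
  by (simp add: fourier_mode_def exp_add[symmetric] inner_add_right distrib_left)

lemma fourier_mode_add_index: "fourier_mode Y (k + l) x = fourier_mode Y k x * fourier_mode Y l x"
proof -
  have "xi Y (k + l) = xi Y k + xi Y l" by (simp add: xi_def vec_eq_iff add_divide_distrib)
  then show ?thesis
    by (simp add: fourier_mode_def exp_add[symmetric] inner_add_left distrib_left)
qed

lemma fourier_mode_uminus: "fourier_mode Y (- k) x = cnj (fourier_mode Y k x)"
proof -
  have "xi Y (- k) = - xi Y k" by (simp add: xi_def vec_eq_iff)
  then show ?thesis by (simp add: fourier_mode_def exp_cnj)
qed

lemma fourier_mode_zero: "fourier_mode Y 0 x = 1"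
proof -
  have "xi Y 0 = 0" by (simp add: xi_def vec_eq_iff)
  then show ?thesis by (simp add: fourier_mode_def)
qed

lemma fourier_mode_axis:
  "fourier_mode Y k (axis \<alpha> t) = exp (\<i> * of_real (pi * (of_int (k $ \<alpha>) / Y $ \<alpha> * t)))"
  by (simp only: fourier_mode_def xi_inner_axis)

lemma fourier_mode_C0_per:
  fixes Y :: "real^'d::finite"
  assumes "\<forall>\<alpha>. 0 < Y $ \<alpha>"
  shows "fourier_mode Y k \<in> C0_per Y"
proof -
  have "fourier_mode Y k (axis \<alpha> (2 * Y $ \<alpha>)) = 1" for \<alpha>
  proof -
    have "Y $ \<alpha> \<noteq> 0" using assms by (metis less_irrefl)
    then have "fourier_mode Y k (axis \<alpha> (2 * Y $ \<alpha>)) = exp (\<i> * of_real (pi * (of_int (k $ \<alpha>) * 2)))"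
      by (simp add: fourier_mode_axis)
    also have "\<dots> = exp (2 * of_int (k $ \<alpha>) * of_real pi * \<i>)"
      by (simp add: mult_ac)
    also have "\<dots> = 1" by (auto simp: exp_eq_1)
    finally show ?thesis .
  qed
  moreover have "continuous_on UNIV (fourier_mode Y k)"
    unfolding fourier_mode_def by (intro continuous_intros)
  ultimately show ?thesis by (simp add: C0_per_def periodic_def fourier_mode_add)
qed

lemma cell_vol_eq_measure:
  fixes Y :: "real^'d::finite"
  assumes "\<forall>\<alpha>. 0 < Y $ \<alpha>"
  shows "cell_vol Y = measure lborel (cell Y)"
proof -
  have "cell Y \<noteq> {}" using assms by (simp add: cell_def interval_ne_empty_cart) (meson less_eq_real_def neg_le_0_iff_le order_trans)
  then have "measure lborel (cell Y) = (\<Prod>\<alpha>\<in>UNIV. 2 * Y $ \<alpha>)"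
    by (simp add: cell_def content_cbox_cart)
  then show ?thesis by (simp add: cell_vol_def prod.distrib)
qed

lemma cell_vol_pos:
  fixes Y :: "real^'d::finite"
  assumes "\<forall>\<alpha>. 0 < Y $ \<alpha>"
  shows "0 < cell_vol Y"
  using assms by (simp add: cell_vol_def prod_pos)

text \<open>Shifting by \<open>Y\<^sub>\<alpha> / \<bar>k\<^sub>\<alpha>\<bar>\<close> changes the sign of the mode.\<close>

lemma integral_fourier_mode:
  fixes Y :: "real^'d::finite"
  assumes Y: "\<forall>\<alpha>. 0 < Y $ \<alpha>"
  shows "integral (cell Y) (fourier_mode Y k) = (if k = 0 then of_real (cell_vol Y) else 0)"
proof (cases "k = 0")
  case True
  then have "fourier_mode Y k = (\<lambda>x. 1)" by (simp add: fun_eq_iff fourier_mode_zero)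
  then show ?thesis
    using True by (simp add: cell_vol_eq_measure[OF Y] cell_def scaleR_conv_of_real)
next
  case False
  then obtain \<alpha> where \<alpha>: "k $ \<alpha> \<noteq> 0" by (auto simp: vec_eq_iff)
  have pos: "0 < Y $ \<alpha>" using Y by simp
  define t where "t = Y $ \<alpha> / \<bar>of_int (k $ \<alpha>)\<bar>"
  have "1 \<le> \<bar>real_of_int (k $ \<alpha>)\<bar>" using \<alpha> by linarith
  then have "t \<le> Y $ \<alpha>" using pos by (simp add: t_def divide_le_eq mult_le_cancel_left1)
  then have t: "0 \<le> t" "t \<le> 2 * Y $ \<alpha>" using pos by (simp_all add: t_def)
  have "fourier_mode Y k (axis \<alpha> t) = exp (\<i> * of_real (pi * sgn (of_int (k $ \<alpha>))))"
    using pos by (simp add: fourier_mode_axis t_def sgn_div_norm divide_simps)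
  also have "\<dots> = - 1"
    using \<alpha> by (cases "k $ \<alpha> > 0") (simp_all add: exp_minus)
  finally have "(\<lambda>x. fourier_mode Y k (x + axis \<alpha> t)) = (\<lambda>x. - fourier_mode Y k x)"
    by (simp add: fun_eq_iff fourier_mode_add)
  with integral_cell_shift[OF Y fourier_mode_C0_per[OF Y] t, of k]
  have "- integral (cell Y) (fourier_mode Y k) = integral (cell Y) (fourier_mode Y k)"
    by simp
  then show ?thesis using False by (simp add: minus_equation_iff eq_neg_iff_add_eq_0)
qed

text \<open>The real part makes this a real smooth function for arbitrary coefficients, so single
  modes can serve as test functions. For conjugate-symmetric coefficients on \<open>ZN N\<close> the
  sum is already real.\<close>

definition trig_sum :: "real^'d \<Rightarrow> (int^'d) set \<Rightarrow> (int^'d \<Rightarrow> complex) \<Rightarrow> real^'d \<Rightarrow> real" where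
  "trig_sum Y S c x = Re (\<Sum>k\<in>S. c k * fourier_mode Y k x)"

lemma fourier_mode_has_derivative:
  "(fourier_mode Y k has_derivative (\<lambda>h. \<i> * of_real (pi * (xi Y k \<bullet> h)) * fourier_mode Y k x)) (at x)"
proof -
  have "((\<lambda>x. \<i> * of_real (pi * (xi Y k \<bullet> x))) has_derivative (\<lambda>h. \<i> * of_real (pi * (xi Y k \<bullet> h)))) (at x)"
    by (intro bounded_linear_imp_has_derivative bounded_linear_const_mult
        bounded_linear_compose[OF bounded_linear_of_real] bounded_linear_inner_right)
  moreover have "(exp has_derivative (*) (exp z)) (at z)" for z :: complex
    using DERIV_exp[of z] by (simp add: has_field_derivative_def)
  ultimately have "((\<lambda>x. exp (\<i> * of_real (pi * (xi Y k \<bullet> x)))) has_derivative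
      (\<lambda>h. exp (\<i> * of_real (pi * (xi Y k \<bullet> x))) * (\<i> * of_real (pi * (xi Y k \<bullet> h))))) (at x)"
    by (rule has_derivative_compose)
  then show ?thesis by (simp add: fourier_mode_def[abs_def] mult_ac)
qed

lemma trig_sum_has_derivative:
  "(trig_sum Y S c has_derivative
     (\<lambda>h. Re (\<Sum>k\<in>S. c k * (\<i> * of_real (pi * (xi Y k \<bullet> h)) * fourier_mode Y k x)))) (at x)"
  unfolding trig_sum_def[abs_def]
  by (intro bounded_linear.has_derivative[OF bounded_linear_Re] has_derivative_sum
      has_derivative_mult_right fourier_mode_has_derivative)

lemma partial_trig_sum:
  fixes Y :: "real^'d::finite"
  shows "partial \<alpha> (trig_sum Y S c) = trig_sum Y S (\<lambda>k. \<i> * of_real (pi * xi Y k $ \<alpha>) * c k)"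
proof
  fix x
  show "partial \<alpha> (trig_sum Y S c) x = trig_sum Y S (\<lambda>k. \<i> * of_real (pi * xi Y k $ \<alpha>) * c k) x"
    unfolding partial_def frechet_derivative_at[OF trig_sum_has_derivative, symmetric]
    by (simp add: trig_sum_def inner_axis mult_ac)
qed

lemma trig_sum_differentiable: "trig_sum Y S c differentiable_on UNIV"
  using trig_sum_has_derivative unfolding differentiable_on_def differentiable_def by blast

text \<open>Differentiation only multiplies the coefficients, so the class is closed under partial
  derivatives; the induction therefore runs over all \<open>c\<close>.\<close>

lemma trig_sum_smooth_per:
  fixes Y :: "real^'d::finite"
  assumes "\<forall>\<alpha>. 0 < Y $ \<alpha>"
  shows "trig_sum Y S c \<in> smooth_per Y"
proof -
  have "Ck n (trig_sum Y S c)" for n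
  proof (induction n arbitrary: c)
    case 0
    then show ?case by (simp add: differentiable_imp_continuous_on trig_sum_differentiable)
  next
    case (Suc n)
    then show ?case by (simp add: partial_trig_sum trig_sum_differentiable)
  qed
  moreover have "periodic Y (trig_sum Y S c)"
    using fourier_mode_C0_per[OF assms] by (simp add: C0_per_def periodic_def trig_sum_def)
  ultimately show ?thesis by (simp add: smooth_per_def)
qed

lemma trig_sum_linear:
  "a * trig_sum Y S c x - b * trig_sum Y S c' x = trig_sum Y S (\<lambda>k. of_real a * c k - of_real b * c' k) x"
  by (simp add: trig_sum_def sum_distrib_left sum_subtractf algebra_simps)

text \<open>Conjugation turns the term of \<open>k\<close> into that of \<open>- k\<close>, and
  negation permutes \<open>ZN N\<close>.\<close>

lemma of_real_trig_sum:
  fixes c :: "int^'d::finite \<Rightarrow> complex"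
  assumes N: "\<forall>\<alpha>. odd (N $ \<alpha>)" and c: "\<And>k. k \<in> ZN N \<Longrightarrow> c k = cnj (c (- k))"
  shows "of_real (trig_sum Y (ZN N) c x) = (\<Sum>k\<in>ZN N. c k * fourier_mode Y k x)"
proof -
  have c': "cnj (c k) = c (- k)" if "k \<in> ZN N" for k
    by (subst c[OF that]) simp
  have "cnj (\<Sum>k\<in>ZN N. c k * fourier_mode Y k x) = (\<Sum>k\<in>ZN N. c (- k) * fourier_mode Y (- k) x)"
    by (simp add: c' fourier_mode_uminus)
  also have "\<dots> = (\<Sum>k\<in>ZN N. c k * fourier_mode Y k x)"
    by (rule sum.reindex_bij_witness[of _ uminus uminus]) (simp_all add: uminus_mem_ZN[OF N])
  finally show ?thesis unfolding trig_sum_def by (intro of_real_Re) (simp only: Reals_cnj_iff)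
qed

text \<open>Once the first factor is known to be real, the real part can be taken of the whole
  product and the single mode replaced by its conjugate. Integration then selects the index
  \<open>m\<close>, and no term for \<open>- m\<close> appears.\<close>

lemma integral_trig_sum_mult:
  fixes Y :: "real^'d::finite"
  assumes Y: "\<forall>\<alpha>. 0 < Y $ \<alpha>" and N: "\<forall>\<alpha>. odd (N $ \<alpha>)"
    and c: "\<And>k. k \<in> ZN N \<Longrightarrow> c k = cnj (c (- k))" and m: "m \<in> ZN N"
  shows "integral (cell Y) (\<lambda>x. trig_sum Y (ZN N) c x * trig_sum Y {m} b x) = cell_vol Y * Re (c m * cnj (b m))"
proof -
  have R: "of_real (trig_sum Y (ZN N) c x) = (\<Sum>k\<in>ZN N. c k * fourier_mode Y k x)" for x
    using c by (rule of_real_trig_sum[OF N])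
  have eq: "trig_sum Y (ZN N) c x * trig_sum Y {m} b x
      = Re (\<Sum>k\<in>ZN N. c k * cnj (b m) * fourier_mode Y (k - m) x)" for x
  proof -
    have "trig_sum Y (ZN N) c x * trig_sum Y {m} b x
        = Re (of_real (trig_sum Y (ZN N) c x) * cnj (b m * fourier_mode Y m x))"
      by (simp add: trig_sum_def)
    then show ?thesis
      unfolding R sum_distrib_right
      by (simp add: fourier_mode_add_index[of Y _ "- m", simplified] fourier_mode_uminus mult_ac)
  qed
  have int: "fourier_mode Y k integrable_on cell Y" for k
    using fourier_mode_C0_per[OF Y, of k] by (simp add: C0_per_def cell_def continuous_integrable_cbox)
  have "((\<lambda>x. \<Sum>k\<in>ZN N. c k * cnj (b m) * fourier_mode Y (k - m) x) has_integral
      (\<Sum>k\<in>ZN N. c k * cnj (b m) * integral (cell Y) (fourier_mode Y (k - m)))) (cell Y)"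
    by (intro has_integral_sum finite_ZN[OF N] has_integral_mult_right integrable_integral int)
  from has_integral_linear[OF this bounded_linear_Re]
  have "((\<lambda>x. trig_sum Y (ZN N) c x * trig_sum Y {m} b x) has_integral
      Re (\<Sum>k\<in>ZN N. c k * cnj (b m) * integral (cell Y) (fourier_mode Y (k - m)))) (cell Y)"
    by (simp only: o_def eq)
  also have "(\<Sum>k\<in>ZN N. c k * cnj (b m) * integral (cell Y) (fourier_mode Y (k - m)))
      = (\<Sum>k\<in>ZN N. if k = m then of_real (cell_vol Y) * (c m * cnj (b m)) else 0)"
    by (intro sum.cong refl) (simp add: integral_fourier_mode[OF Y])
  also have "\<dots> = of_real (cell_vol Y) * (c m * cnj (b m))"
    using m finite_ZN[OF N] by simp
  finally have "((\<lambda>x. trig_sum Y (ZN N) c x * trig_sum Y {m} b x) has_integral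
      Re (of_real (cell_vol Y) * (c m * cnj (b m)))) (cell Y)" .
  then show ?thesis by (subst integral_unique) simp_all
qed

section \<open>Vector-valued polynomials and their gradient coefficients\<close>

definition trigfun :: "real^'d \<Rightarrow> nat^'d \<Rightarrow> (int^'d \<Rightarrow> complex^'d) \<Rightarrow> real^'d \<Rightarrow> real^'d" where
  "trigfun Y N c x = (\<chi> i. trig_sum Y (ZN N) (\<lambda>k. c k $ i) x)"

definition conj_symm :: "nat^'d \<Rightarrow> (int^'d \<Rightarrow> complex^'d) \<Rightarrow> bool" where
  "conj_symm N c \<longleftrightarrow> (\<forall>k\<in>ZN N. \<forall>i. c k $ i = cnj (c (- k) $ i))"

text \<open>The Fourier coefficients of gradients of periodic functions.\<close>

definition grad_coeffs :: "real^'d \<Rightarrow> nat^'d \<Rightarrow> (int^'d \<Rightarrow> complex^'d) set" where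
  "grad_coeffs Y N = {c. conj_symm N c \<and> c 0 = 0 \<and>
     (\<forall>k\<in>ZN N. \<forall>\<alpha> \<beta>. of_real (xi Y k $ \<beta>) * c k $ \<alpha> = of_real (xi Y k $ \<alpha>) * c k $ \<beta>)}"

lemma cvec_trigfun:
  fixes N :: "nat^'d::finite"
  assumes "\<forall>\<alpha>. odd (N $ \<alpha>)" and "conj_symm N c"
  shows "cvec (trigfun Y N c x) = (\<Sum>k\<in>ZN N. fourier_mode Y k x *s c k)"
proof -
  have "of_real (trig_sum Y (ZN N) (\<lambda>k. c k $ i) x) = (\<Sum>k\<in>ZN N. c k $ i * fourier_mode Y k x)" for i
    using assms(2) by (intro of_real_trig_sum[OF assms(1)]) (auto simp: conj_symm_def)
  then show ?thesis by (simp add: vec_eq_iff trigfun_def mult.commute)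
qed

lemma trig_polys_eq_image:
  fixes N :: "nat^'d::finite"
  assumes "\<forall>\<alpha>. odd (N $ \<alpha>)"
  shows "trig_polys Y N = trigfun Y N ` {c. conj_symm N c}"
proof (intro equalityI subsetI)
  fix u assume "u \<in> trig_polys Y N"
  then obtain c where c: "conj_symm N c" and u: "\<And>x. cvec (u x) = (\<Sum>k\<in>ZN N. fourier_mode Y k x *s c k)"
    by (auto simp: trig_polys_def conj_symm_def)
  have "cvec (u x) = cvec (trigfun Y N c x)" for x
    using u cvec_trigfun[OF assms c] by simp
  then have "u = trigfun Y N c" by (simp add: vec_eq_iff fun_eq_iff)
  with c show "u \<in> trigfun Y N ` {c. conj_symm N c}" by simp
next
  fix u assume "u \<in> trigfun Y N ` {c. conj_symm N c}"
  then show "u \<in> trig_polys Y N"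
    using cvec_trigfun[OF assms] by (auto simp: trig_polys_def conj_symm_def)
qed

lemma trigfun_C0_per:
  fixes Y :: "real^'d::finite"
  assumes "\<forall>\<alpha>. 0 < Y $ \<alpha>"
  shows "trigfun Y N c \<in> C0_per Y"
proof -
  note s = smooth_perD[OF trig_sum_smooth_per[OF assms]]
  have "continuous_on UNIV (\<lambda>x. \<chi> i. trig_sum Y (ZN N) (\<lambda>k. c k $ i) x)"
    by (intro continuous_on_vec_lambda s(3))
  moreover have "periodic Y (trigfun Y N c)"
    using s(1) by (simp add: periodic_def trigfun_def)
  ultimately show ?thesis by (simp add: C0_per_def trigfun_def[abs_def])
qed

lemma EN_space_eq_image:
  fixes Y :: "real^'d::finite"
  assumes Y: "\<forall>\<alpha>. 0 < Y $ \<alpha>" and N: "\<forall>\<alpha>. odd (N $ \<alpha>)"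
  shows "EN_space Y N = trigfun Y N ` grad_coeffs Y N"
proof -
  have "trigfun Y N c \<in> E_space Y \<longleftrightarrow> c \<in> grad_coeffs Y N" if c: "conj_symm N c" for c
  proof
    note sm = trig_sum_smooth_per[OF Y]
    note cont = smooth_perD(3)[OF sm]
    have cs: "c k $ i = cnj (c (- k) $ i)" if "k \<in> ZN N" for k i
      using c that by (auto simp: conj_symm_def)
    \<comment> \<open>The mean is the product with the constant mode, hence an instance of
      \<open>integral_trig_sum_mult\<close> with \<open>m = 0\<close>.\<close>
    have mean: "(LINT x:cell Y|lebesgue. trigfun Y N c x) $ i = cell_vol Y * Re (c 0 $ i)" for i
    proof -
      have cT: "continuous_on UNIV (trigfun Y N c)"
        using trigfun_C0_per[OF Y, of N c] by (simp add: C0_per_def)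
      have one: "trig_sum Y {0} (\<lambda>_. 1) x = 1" for x by (simp add: trig_sum_def fourier_mode_zero)
      have "(LINT x:cell Y|lebesgue. trigfun Y N c x) $ i = integral (cell Y) (trigfun Y N c) $ i"
        by (simp add: LINT_cell_continuous[OF cT])
      also have "\<dots> = integral (cell Y) (\<lambda>x. trigfun Y N c x $ i)"
        using integral_linear[OF continuous_integrable_cbox[OF cT] bounded_linear_vec_nth[of i], of "- Y" Y]
        by (simp add: o_def cell_def)
      also have "\<dots> = cell_vol Y * Re (c 0 $ i)"
      proof -
        have "integral (cell Y) (\<lambda>x. trig_sum Y (ZN N) (\<lambda>k. c k $ i) x * trig_sum Y {0} (\<lambda>_. 1) x)
            = cell_vol Y * Re (c 0 $ i * cnj 1)"
          by (rule integral_trig_sum_mult[OF Y N _ zero_mem_ZN[OF N]]) (rule cs)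
        then show ?thesis by (simp add: trigfun_def one)
      qed
      finally show ?thesis .
    qed
    {
      assume u: "trigfun Y N c \<in> E_space Y"
      have "c 0 $ i = 0" for i
      proof -
        have "Re (c 0 $ i) = 0" using mean[of i] u cell_vol_pos[OF Y] by (simp add: E_space_def)
        \<comment> \<open>The mean of the real function sees only the real part of
          \<open>c 0\<close>; the imaginary part vanishes because 0 is its own opposite.\<close>
        moreover have "Im (c 0 $ i) = 0"
          using cs[OF zero_mem_ZN[OF N], of i] by (simp add: complex_eq_iff)
        ultimately show ?thesis by (simp add: complex_eq_iff)
      qed
      moreover have "of_real (xi Y m $ \<beta>) * c m $ \<alpha> = of_real (xi Y m $ \<alpha>) * c m $ \<beta>"
        if m: "m \<in> ZN N" for m \<alpha> \<beta>
      proof -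
        \<comment> \<open>The weights are taken from the fixed frequency \<open>m\<close>, not from
          \<open>k\<close>: they must be real constants for \<open>d\<close> to inherit conjugate
          symmetry from \<open>c\<close>.\<close>
        define d where "d k = of_real (xi Y m $ \<beta>) * c k $ \<alpha> - of_real (xi Y m $ \<alpha>) * c k $ \<beta>" for k
        have dsum: "trig_sum Y (ZN N) d x = xi Y m $ \<beta> * trig_sum Y (ZN N) (\<lambda>k. c k $ \<alpha>) x
            - xi Y m $ \<alpha> * trig_sum Y (ZN N) (\<lambda>k. c k $ \<beta>) x" for x
          by (simp only: trig_sum_linear d_def[abs_def])
        \<comment> \<open>Both partial derivatives of the test function \<open>v\<close> are multiples of the \<open>m\<close>-th mode
          of the combination \<open>d\<close>, so that testing \<open>curl_free\<close> with \<open>v\<close> gives the squared modulus of \<open>d m\<close>.\<close>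
        define v where "v = trig_sum Y {m} (\<lambda>k. d m / (\<i> * of_real pi))"
        have v: "v \<in> smooth_per Y" unfolding v_def by (rule sm)
        have pv: "partial \<gamma> v x = xi Y m $ \<gamma> * trig_sum Y {m} (\<lambda>k. d m) x" for \<gamma> x
          unfolding v_def partial_trig_sum by (simp add: trig_sum_def algebra_simps)
        have "v \<in> H1_per Y"
          using weak_partial_smooth[OF Y v] C0_per_imp_L2_per[OF smooth_perD(5)[OF v]]
          by (auto simp: H1_per_def)
        then have "(LINT x:cell Y|lebesgue. trigfun Y N c x $ \<alpha> * partial \<beta> v x - trigfun Y N c x $ \<beta> * partial \<alpha> v x) = 0"
          using u weak_partial_smooth[OF Y v] by (simp add: E_space_def curl_free_def)
        also have "(\<lambda>x. trigfun Y N c x $ \<alpha> * partial \<beta> v x - trigfun Y N c x $ \<beta> * partial \<alpha> v x)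
            = (\<lambda>x. trig_sum Y (ZN N) d x * trig_sum Y {m} (\<lambda>k. d m) x)"
          by (simp add: fun_eq_iff trigfun_def pv dsum algebra_simps)
        also have "(LINT x:cell Y|lebesgue. trig_sum Y (ZN N) d x * trig_sum Y {m} (\<lambda>k. d m) x)
            = integral (cell Y) (\<lambda>x. trig_sum Y (ZN N) d x * trig_sum Y {m} (\<lambda>k. d m) x)"
          by (intro LINT_cell_continuous continuous_intros cont)
        also have "\<dots> = cell_vol Y * Re (d m * cnj (d m))"
        proof (rule integral_trig_sum_mult[OF Y N _ m])
          fix k assume k: "k \<in> ZN N"
          then show "d k = cnj (d (- k))"
            by (simp add: d_def cs[OF k, of \<alpha>] cs[OF k, of \<beta>])
        qed
        finally have "Re (d m * cnj (d m)) = 0" using cell_vol_pos[OF Y] by simp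
        then have "d m = 0"
          by (simp add: complex_eq_iff)
        then show ?thesis by (simp add: d_def)
      qed
      ultimately show "c \<in> grad_coeffs Y N"
        using c by (simp add: grad_coeffs_def vec_eq_iff)
    }
    {
      assume g: "c \<in> grad_coeffs Y N"
      have "curl_free Y (trigfun Y N c)"
        unfolding curl_free_def
      proof (intro allI ballI impI)
        fix \<alpha> \<beta> v v\<alpha> v\<beta>
        assume w: "weak_partial Y \<alpha> v v\<alpha>" "weak_partial Y \<beta> v v\<beta>"
        define U where "U i = trig_sum Y (ZN N) (\<lambda>k. c k $ i)" for i
        have U: "U i \<in> smooth_per Y" for i unfolding U_def by (rule sm)
        \<comment> \<open>Parallelism of coefficient and frequency is exactly equality of the cross
          derivatives. With \<open>U \<alpha>\<close> and \<open>U \<beta>\<close> as smooth test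
          functions, the two weak derivative identities then share their left-hand side.\<close>
        have "partial \<beta> (U \<alpha>) = partial \<alpha> (U \<beta>)"
          using g unfolding U_def partial_trig_sum
          by (auto simp: fun_eq_iff trig_sum_def grad_coeffs_def mult_ac intro!: sum.cong)
        moreover have "(LINT x:cell Y|lebesgue. v x * partial \<beta> (U \<alpha>) x) = - (LINT x:cell Y|lebesgue. v\<beta> x * U \<alpha> x)"
          "(LINT x:cell Y|lebesgue. v x * partial \<alpha> (U \<beta>) x) = - (LINT x:cell Y|lebesgue. v\<alpha> x * U \<beta> x)"
          using w U unfolding weak_partial_def by blast+
        ultimately have eq: "(LINT x:cell Y|lebesgue. v\<beta> x * U \<alpha> x) = (LINT x:cell Y|lebesgue. v\<alpha> x * U \<beta> x)"
          by simp
        have "(LINT x:cell Y|lebesgue. U \<alpha> x * v\<beta> x - U \<beta> x * v\<alpha> x)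
            = (LINT x:cell Y|lebesgue. U \<alpha> x * v\<beta> x) - (LINT x:cell Y|lebesgue. U \<beta> x * v\<alpha> x)"
          using w by (intro set_integral_diff(2) set_integrable_L2_times_continuous smooth_perD(3)[OF U])
            (auto simp: weak_partial_def)
        then show "(LINT x:cell Y|lebesgue. trigfun Y N c x $ \<alpha> * v\<beta> x - trigfun Y N c x $ \<beta> * v\<alpha> x) = 0"
          using eq by (simp add: trigfun_def U_def mult.commute)
      qed
      moreover have "(LINT x:cell Y|lebesgue. trigfun Y N c x) = 0"
        using mean g by (simp add: vec_eq_iff grad_coeffs_def)
      ultimately show "trigfun Y N c \<in> E_space Y"
        using C0_per_imp_L2_per[OF trigfun_C0_per[OF Y]] by (simp add: E_space_def)
    }
  qed
  then show ?thesis
    unfolding EN_space_def trig_polys_eq_image[OF N] by (auto simp: grad_coeffs_def)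
qed

text \<open>Parseval's identity from the orthogonality of the modes. It is stated for arbitrary
  complex coefficients, so it applies to \<open>interp\<close> without a proof that the interpolant
  is real.\<close>

lemma L2_inner_modes:
  fixes Y :: "real^'d::finite"
  assumes Y: "\<forall>\<alpha>. 0 < Y $ \<alpha>" and N: "\<forall>\<alpha>. odd (N $ \<alpha>)"
  shows "L2_inner Y (\<lambda>x. \<Sum>k\<in>ZN N. fourier_mode Y k x *s a k) (\<lambda>x. \<Sum>k\<in>ZN N. fourier_mode Y k x *s b k)
    = (\<Sum>k\<in>ZN N. \<Sum>i\<in>UNIV. a k $ i * cnj (b k $ i))"
proof -
  have cont: "continuous_on UNIV (fourier_mode Y k)" for k
    using fourier_mode_C0_per[OF Y, of k] by (simp add: C0_per_def)
  have eq: "(\<Sum>i\<in>UNIV. (\<Sum>k\<in>ZN N. fourier_mode Y k x *s a k) $ i * cnj ((\<Sum>k\<in>ZN N. fourier_mode Y k x *s b k) $ i))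
      = (\<Sum>i\<in>UNIV. \<Sum>k\<in>ZN N. \<Sum>l\<in>ZN N. a k $ i * cnj (b l $ i) * fourier_mode Y (k - l) x)" for x
    by (simp add: sum_product fourier_mode_add_index[of Y _ "- _", simplified] fourier_mode_uminus mult_ac)
  have "((\<lambda>x. \<Sum>i\<in>UNIV. \<Sum>k\<in>ZN N. \<Sum>l\<in>ZN N. a k $ i * cnj (b l $ i) * fourier_mode Y (k - l) x) has_integral
      (\<Sum>i\<in>UNIV. \<Sum>k\<in>ZN N. \<Sum>l\<in>ZN N. a k $ i * cnj (b l $ i) * integral (cell Y) (fourier_mode Y (k - l)))) (cell Y)"
    using continuous_integrable_cbox[OF cont]
    by (intro has_integral_sum finite_ZN[OF N] has_integral_mult_right integrable_integral) (simp_all add: cell_def)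
  then have "integral (cell Y) (\<lambda>x. \<Sum>i\<in>UNIV. \<Sum>k\<in>ZN N. \<Sum>l\<in>ZN N. a k $ i * cnj (b l $ i) * fourier_mode Y (k - l) x)
      = (\<Sum>i\<in>UNIV. \<Sum>k\<in>ZN N. \<Sum>l\<in>ZN N. if l = k then a k $ i * cnj (b k $ i) * of_real (cell_vol Y) else 0)"
    by (subst integral_unique, assumption, intro sum.cong refl) (simp add: integral_fourier_mode[OF Y])
  also have "\<dots> = (\<Sum>k\<in>ZN N. \<Sum>i\<in>UNIV. a k $ i * cnj (b k $ i)) * of_real (cell_vol Y)"
    using finite_ZN[OF N] by (subst sum.swap) (simp add: sum_distrib_right)
  finally have "(LINT x:cell Y|lebesgue. \<Sum>i\<in>UNIV. \<Sum>k\<in>ZN N. \<Sum>l\<in>ZN N. a k $ i * cnj (b l $ i) * fourier_mode Y (k - l) x)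
      = (\<Sum>k\<in>ZN N. \<Sum>i\<in>UNIV. a k $ i * cnj (b k $ i)) * of_real (cell_vol Y)"
    by (subst LINT_cell_continuous) (intro continuous_intros cont, simp)
  then show ?thesis using cell_vol_pos[OF Y] unfolding L2_inner_def eq by simp
qed

lemma fourier_mode_grid:
  fixes Y :: "real^'d::finite"
  assumes "\<forall>\<alpha>. 0 < Y $ \<alpha>"
  shows "fourier_mode Y j (grid Y N k) = omega N k j"
proof -
  have "Y $ \<alpha> \<noteq> 0" for \<alpha> using assms by (metis less_irrefl)
  then have "xi Y j \<bullet> grid Y N k = 2 * (\<Sum>\<alpha>\<in>UNIV. of_int (k $ \<alpha>) * of_int (j $ \<alpha>) / real (N $ \<alpha>))"
    by (simp add: xi_def grid_def inner_vec_def sum_distrib_left mult_ac)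
  then show ?thesis by (simp add: fourier_mode_def omega_def mult_ac)
qed

text \<open>The exponent of the shape function separates into a mode at \<open>x\<close> and the
  conjugate of a mode at the node, so exchanging the sums produces the discrete Fourier coefficients
  of the samples.\<close>

lemma interp_eq_modes:
  fixes Y :: "real^'d::finite"
  shows "interp Y N f x = (\<Sum>m\<in>ZN N. fourier_mode Y m x *s smat_app N (DFT N) (csvec (sample Y N f)) m)"
proof -
  have "shape_fun Y N k x = (\<Sum>m\<in>ZN N. fourier_mode Y m x * omega N (- m) k) / of_nat (Ntot N)" for k
  proof -
    have "\<i> * of_real (pi * (\<Sum>\<alpha>\<in>UNIV. of_int (m $ \<alpha>) * (x $ \<alpha> / Y $ \<alpha> - 2 * of_int (k $ \<alpha>) / real (N $ \<alpha>))))
      = \<i> * of_real (pi * (xi Y m \<bullet> x)) + 2 * of_real pi * \<i> * of_real (\<Sum>\<alpha>\<in>UNIV. of_int ((- m) $ \<alpha>) * of_int (k $ \<alpha>) / real (N $ \<alpha>))" for m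
      by (simp add: xi_def inner_vec_def right_diff_distrib sum_subtractf sum_distrib_left sum_negf algebra_simps)
    then show ?thesis by (simp add: shape_fun_def fourier_mode_def omega_def exp_add)
  qed
  then show ?thesis
    by (simp add: vec_eq_iff interp_def smat_app_DFT_nth csvec_def sample_def sum_distrib_left sum_distrib_right
        sum_divide_distrib mult_ac) (intro allI, rule sum.swap)
qed

section \<open>The discrete Green operator\<close>

lemma smat_app_cong:
  "(\<And>k. k \<in> ZN N \<Longrightarrow> v k = w k) \<Longrightarrow> smat_app N M v = smat_app N M w"
  by (simp add: smat_app_def fun_eq_iff)

lemma smat_app_add: "smat_app N M (v + w) = smat_app N M v + smat_app N M w"
  by (simp add: smat_app_def fun_eq_iff matrix_vector_right_distrib sum.distrib)

lemma smat_app_diff: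
  fixes M :: "('a::comm_ring_1, 'd::finite) smat"
  shows "smat_app N M (v - w) = smat_app N M v - smat_app N M w"
  using smat_app_add[of N M "v - w" w] by (simp add: algebra_simps)

lemma smat_app_add_mat: "smat_app N (L + M) v = smat_app N L v + smat_app N M v"
  by (simp add: smat_app_def fun_eq_iff matrix_vector_mult_add_rdistrib sum.distrib)

lemma smat_app_diff_mat:
  fixes M :: "('a::comm_ring_1, 'd::finite) smat"
  shows "smat_app N (L - M) v = smat_app N L v - smat_app N M v"
  using smat_app_add_mat[of N "L - M" M v] by (simp add: algebra_simps)

lemma csvec_eq_iff: "csvec v = csvec w \<longleftrightarrow> v = w"
  by (simp add: csvec_def fun_eq_iff vec_eq_iff)

lemma csvec_add: "csvec (v + w) = csvec v + csvec w"
  by (simp add: csvec_def fun_eq_iff vec_eq_iff)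

lemma csvec_uminus: "csvec (- v) = - csvec v"
  by (simp add: csvec_def fun_eq_iff vec_eq_iff)

lemma csvec_diff: "csvec (v - w) = csvec v - csvec w"
  by (simp add: csvec_def fun_eq_iff vec_eq_iff)

lemma map_matrix_of_real_cvec: "map_matrix complex_of_real M *v cvec x = cvec (M *v x)"
  by (simp add: vec_eq_iff matrix_vector_mult_def map_matrix_def)

lemma smat_app_csmat: "smat_app N (csmat M) (csvec v) = csvec (smat_app N M v)"
  by (simp add: smat_app_def csmat_def csvec_def fun_eq_iff map_matrix_of_real_cvec)
    (simp add: vec_eq_iff)

lemma sample_mem_svecs: "sample Y N u \<in> svecs N"
  by (simp add: sample_def svecs_def)

lemma E_vec_mem_svecs: "E_vec N E \<in> svecs N"
  by (simp add: E_vec_def svecs_def)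

lemma svecs_eqI:
  assumes "v \<in> svecs N" "w \<in> svecs N" "\<And>k. k \<in> ZN N \<Longrightarrow> v k = w k"
  shows "v = w"
proof
  fix k
  show "v k = w k" using assms by (cases "k \<in> ZN N") (simp_all add: svecs_def)
qed

lemma svec_inner_add_left: "svec_inner N (u + v) w = svec_inner N u w + svec_inner N v w"
  by (simp add: svec_inner_def inner_add_left sum.distrib distrib_left add_divide_distrib)

lemma svec_inner_self_eq_0:
  fixes N :: "nat^'d::finite"
  assumes "\<forall>\<alpha>. odd (N $ \<alpha>)" and "v \<in> svecs N" and "svec_inner N v v = 0"
  shows "v = 0"
proof (rule svecs_eqI[OF assms(2)])
  have "(\<Sum>k\<in>ZN N. v k \<bullet> v k) = 0"
    using assms(3) Ntot_pos[OF assms(1)] by (simp add: svec_inner_def)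
  then show "v k = 0 k" if "k \<in> ZN N" for k
    using that finite_ZN[OF assms(1)] by (subst (asm) sum_nonneg_eq_0_iff) auto
qed (simp add: svecs_def)

section \<open>Sampling, and the discrete counterpart of the Galerkin problem\<close>

lemma csvec_sample_trigfun:
  fixes Y :: "real^'d::finite"
  assumes Y: "\<forall>\<alpha>. 0 < Y $ \<alpha>" and N: "\<forall>\<alpha>. odd (N $ \<alpha>)" and c: "conj_symm N c"
  shows "csvec (sample Y N (trigfun Y N c)) = smat_app N (iDFT N) c"
proof
  fix k
  show "csvec (sample Y N (trigfun Y N c)) k = smat_app N (iDFT N) c k"
    using cvec_trigfun[OF N c, of Y "grid Y N k"]
    by (cases "k \<in> ZN N")
      (simp_all add: csvec_def sample_def vec_eq_iff smat_app_iDFT_nth fourier_mode_grid[OF Y])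
qed

lemma DFT_sample_trigfun:
  fixes Y :: "real^'d::finite"
  assumes Y: "\<forall>\<alpha>. 0 < Y $ \<alpha>" and N: "\<forall>\<alpha>. odd (N $ \<alpha>)" and c: "conj_symm N c" and k: "k \<in> ZN N"
  shows "smat_app N (DFT N) (csvec (sample Y N (trigfun Y N c))) k = c k"
  by (simp add: csvec_sample_trigfun[OF Y N c] DFT_iDFT[OF N k])

lemma trigfun_cong:
  "(\<And>k. k \<in> ZN N \<Longrightarrow> c k = c' k) \<Longrightarrow> trigfun Y N c = trigfun Y N c'"
  by (simp add: trigfun_def trig_sum_def fun_eq_iff vec_eq_iff)

text \<open>The discrete Fourier transform recovers the coefficients from the samples. Uniqueness of
  the Galerkin solution follows from uniqueness of its samples.\<close>

lemma inj_on_sample_EN_space: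
  fixes Y :: "real^'d::finite"
  assumes Y: "\<forall>\<alpha>. 0 < Y $ \<alpha>" and N: "\<forall>\<alpha>. odd (N $ \<alpha>)"
  shows "inj_on (sample Y N) (EN_space Y N)"
proof (rule inj_onI)
  fix u v assume "u \<in> EN_space Y N" "v \<in> EN_space Y N" and eq: "sample Y N u = sample Y N v"
  then obtain c c' where c: "conj_symm N c" "u = trigfun Y N c" and c': "conj_symm N c'" "v = trigfun Y N c'"
    unfolding EN_space_eq_image[OF Y N] by (auto simp: grad_coeffs_def)
  show "u = v"
    unfolding c(2) c'(2)
    using DFT_sample_trigfun[OF Y N c(1)] DFT_sample_trigfun[OF Y N c'(1)] eq c(2) c'(2)
    by (intro trigfun_cong) simp
qed

text \<open>Discrete Parseval identity: the conjugate of the kernel of \<open>iDFT\<close>, with the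
  weight of \<open>svec_inner\<close>, is the kernel of \<open>DFT\<close>, so the transform moves
  to the arbitrary vector \<open>f\<close>.\<close>

lemma svec_inner_sample_trigfun:
  fixes Y :: "real^'d::finite"
  assumes Y: "\<forall>\<alpha>. 0 < Y $ \<alpha>" and N: "\<forall>\<alpha>. odd (N $ \<alpha>)" and c: "conj_symm N c"
  shows "of_real (svec_inner N f (sample Y N (trigfun Y N c)))
    = (\<Sum>m\<in>ZN N. \<Sum>i\<in>UNIV. smat_app N (DFT N) (csvec f) m $ i * cnj (c m $ i))"
proof -
  let ?s = "sample Y N (trigfun Y N c)"
  \<comment> \<open>The samples are real, hence equal to their conjugates; this is where the sign in
    \<open>omega\<close> changes.\<close>
  have s: "complex_of_real (?s k $ i) = (\<Sum>m\<in>ZN N. omega N (- m) k * cnj (c m $ i))" if "k \<in> ZN N" for k i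
  proof -
    have "complex_of_real (?s k $ i) = cnj (csvec ?s k $ i)" by (simp add: csvec_def)
    also have "\<dots> = (\<Sum>m\<in>ZN N. omega N (- m) k * cnj (c m $ i))"
      using that by (simp add: csvec_sample_trigfun[OF Y N c] smat_app_iDFT_nth omega_uminus omega_commute[of N k])
    finally show ?thesis .
  qed
  have "complex_of_real (svec_inner N f ?s) = (\<Sum>k\<in>ZN N. \<Sum>i\<in>UNIV. of_real (f k $ i) * of_real (?s k $ i)) / of_nat (Ntot N)"
    by (simp add: svec_inner_def inner_vec_def)
  also have "\<dots> = (\<Sum>k\<in>ZN N. \<Sum>i\<in>UNIV. \<Sum>m\<in>ZN N. of_real (f k $ i) * (omega N (- m) k * cnj (c m $ i)) / of_nat (Ntot N))"
    by (simp add: s sum_distrib_left sum_divide_distrib)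
  also have "\<dots> = (\<Sum>k\<in>ZN N. \<Sum>m\<in>ZN N. \<Sum>i\<in>UNIV. of_real (f k $ i) * (omega N (- m) k * cnj (c m $ i)) / of_nat (Ntot N))"
    by (intro sum.cong refl sum.swap)
  also have "\<dots> = (\<Sum>m\<in>ZN N. \<Sum>k\<in>ZN N. \<Sum>i\<in>UNIV. of_real (f k $ i) * (omega N (- m) k * cnj (c m $ i)) / of_nat (Ntot N))"
    by (rule sum.swap)
  also have "\<dots> = (\<Sum>m\<in>ZN N. \<Sum>i\<in>UNIV. \<Sum>k\<in>ZN N. of_real (f k $ i) * (omega N (- m) k * cnj (c m $ i)) / of_nat (Ntot N))"
    by (intro sum.cong refl sum.swap)
  also have "\<dots> = (\<Sum>m\<in>ZN N. \<Sum>i\<in>UNIV. smat_app N (DFT N) (csvec f) m $ i * cnj (c m $ i))"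
    by (intro sum.cong refl) (simp add: smat_app_DFT_nth csvec_def sum_distrib_left sum_distrib_right sum_divide_distrib mult_ac)
  finally show ?thesis .
qed

text \<open>By the continuous and the discrete Parseval identity both products are the same sum over
  coefficients, since the interpolant has the discrete coefficients of \<open>f\<close>.\<close>

lemma L2_inner_interp:
  fixes Y :: "real^'d::finite"
  assumes Y: "\<forall>\<alpha>. 0 < Y $ \<alpha>" and N: "\<forall>\<alpha>. odd (N $ \<alpha>)" and v: "v \<in> EN_space Y N"
  shows "L2_inner Y (interp Y N f) (\<lambda>x. cvec (v x)) = of_real (svec_inner N (sample Y N f) (sample Y N v))"
proof -
  obtain c where c: "conj_symm N c" "v = trigfun Y N c"
    using v unfolding EN_space_eq_image[OF Y N] by (auto simp: grad_coeffs_def)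
  show ?thesis
    unfolding c(2) interp_eq_modes[abs_def] cvec_trigfun[OF N c(1)] L2_inner_modes[OF Y N]
      svec_inner_sample_trigfun[OF Y N c(1)] ..
qed

lemma smat_app_A_mat:
  fixes N :: "nat^'d::finite"
  assumes "\<forall>\<alpha>. odd (N $ \<alpha>)"
  shows "smat_app N (A_mat Y N A) v = (\<lambda>k. if k \<in> ZN N then A (grid Y N k) *v v k else 0)"
  by (simp add: A_mat_def smat_app_diag[OF assms])

lemma galerkin_ni_sol_iff:
  fixes Y :: "real^'d::finite"
  assumes Y: "\<forall>\<alpha>. 0 < Y $ \<alpha>" and N: "\<forall>\<alpha>. odd (N $ \<alpha>)"
  shows "galerkin_ni_sol Y N A E u \<longleftrightarrow> u \<in> EN_space Y N \<and> discrete_sol Y N A E (sample Y N u)"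
proof -
  have 1: "sample Y N (\<lambda>x. A x *v u x) = smat_app N (A_mat Y N A) (sample Y N u)"
    and 2: "sample Y N (\<lambda>x. A x *v E) = smat_app N (A_mat Y N A) (E_vec N E)"
    by (simp_all add: smat_app_A_mat[OF N] sample_def E_vec_def fun_eq_iff)
  have "- complex_of_real r = of_real (- r)" for r by simp
  then have "L2_inner Y (interp Y N (\<lambda>x. A x *v u x)) (\<lambda>x. cvec (v x)) =
        - L2_inner Y (interp Y N (\<lambda>x. A x *v E)) (\<lambda>x. cvec (v x)) \<longleftrightarrow>
      svec_inner N (smat_app N (A_mat Y N A) (sample Y N u)) (sample Y N v) =
        - svec_inner N (smat_app N (A_mat Y N A) (E_vec N E)) (sample Y N v)"
    if "v \<in> EN_space Y N" for v
    unfolding L2_inner_interp[OF Y N that] 1 2 by (metis of_real_eq_iff)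
  then show ?thesis by (auto simp: galerkin_ni_sol_def discrete_sol_def EEN_def)
qed

definition green_coeffs :: "real^'d \<Rightarrow> nat^'d \<Rightarrow> real^'d^'d \<Rightarrow> (real, 'd::finite) svec \<Rightarrow> (complex, 'd) svec" where
  "green_coeffs Y N A0 v k = map_matrix complex_of_real (Gamma_hat Y A0 k) *v smat_app N (DFT N) (csvec v) k"

text \<open>The matrix \<open>Gamma0\<close> acting on real vectors, as
  \<open>csvec_green_op\<close> shows. Defining it through a sampled polynomial makes real values
  and vanishing outside \<open>ZN N\<close> immediate.\<close>

definition green_op :: "real^'d \<Rightarrow> nat^'d \<Rightarrow> real^'d^'d \<Rightarrow> (real, 'd::finite) svec \<Rightarrow> (real, 'd) svec" where
  "green_op Y N A0 v = sample Y N (trigfun Y N (green_coeffs Y N A0 v))"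

text \<open>With \<open>s = 0\<close> at the zero frequency, both cases of the definition take one
  form.\<close>

lemma Gamma_hat_rank_one:
  obtains s where "Gamma_hat Y A0 k = (\<chi> i j. s * (xi Y k $ i * xi Y k $ j))"
proof (cases "k = 0")
  case True
  then show ?thesis using that[of 0] by (simp add: Gamma_hat_def vec_eq_iff)
next
  case False
  then have "Gamma_hat Y A0 k = (\<chi> i j. 1 / ((A0 *v xi Y k) \<bullet> xi Y k) * (xi Y k $ i * xi Y k $ j))"
    by (simp add: Gamma_hat_def) (simp add: vec_eq_iff)
  then show ?thesis by (rule that)
qed

lemma Gamma_hat_symmetric: "Gamma_hat Y A0 k $ i $ j = Gamma_hat Y A0 k $ j $ i"
  by (simp add: Gamma_hat_def mult.commute)

lemma Gamma_hat_uminus: "Gamma_hat Y A0 (- k) = Gamma_hat Y A0 k"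
proof -
  have "xi Y (- k) = - xi Y k" by (simp add: xi_def vec_eq_iff)
  moreover have "A0 *v (- x) = - (A0 *v x)" for x
    using matrix_vector_mult_diff_distrib[of A0 0 x] by simp
  ultimately show ?thesis by (simp add: Gamma_hat_def)
qed

text \<open>A multiple of \<xi> \<otimes> \<xi> has its range on the line of \<xi>. Conjugate
  symmetry holds because the transform of a real vector has it and \<open>Gamma_hat\<close> is real
  and even in \<open>k\<close>.\<close>

lemma green_coeffs_in_grad_coeffs:
  fixes Y :: "real^'d::finite"
  assumes N: "\<forall>\<alpha>. odd (N $ \<alpha>)"
  shows "green_coeffs Y N A0 v \<in> grad_coeffs Y N"
proof -
  have "green_coeffs Y N A0 v 0 = 0"
    by (simp add: green_coeffs_def Gamma_hat_def vec_eq_iff matrix_vector_mult_def map_matrix_def)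
  moreover have "of_real (xi Y k $ \<beta>) * green_coeffs Y N A0 v k $ \<alpha>
      = of_real (xi Y k $ \<alpha>) * green_coeffs Y N A0 v k $ \<beta>" for k \<alpha> \<beta>
  proof -
    obtain s where "Gamma_hat Y A0 k = (\<chi> i j. s * (xi Y k $ i * xi Y k $ j))"
      by (rule Gamma_hat_rank_one)
    then show ?thesis
      by (simp add: green_coeffs_def matrix_vector_mult_def map_matrix_def sum_distrib_left mult_ac)
  qed
  moreover have "green_coeffs Y N A0 v k $ i = cnj (green_coeffs Y N A0 v (- k) $ i)" if "k \<in> ZN N" for k i
  proof -
    have "cnj (smat_app N (DFT N) (csvec v) (- k) $ j) = smat_app N (DFT N) (csvec v) k $ j" for j
      using that uminus_mem_ZN[OF N, of k]
      by (simp add: smat_app_DFT_nth csvec_def omega_uminus)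
    then show ?thesis
      by (simp add: green_coeffs_def Gamma_hat_uminus matrix_vector_mult_def map_matrix_def)
  qed
  ultimately show ?thesis unfolding grad_coeffs_def conj_symm_def by blast
qed

lemma green_coeffs_conj_symm:
  fixes Y :: "real^'d::finite"
  assumes N: "\<forall>\<alpha>. odd (N $ \<alpha>)"
  shows "conj_symm N (green_coeffs Y N A0 v)"
  using green_coeffs_in_grad_coeffs[OF N, of Y A0 v] by (simp add: grad_coeffs_def)

lemma csvec_green_op:
  fixes Y :: "real^'d::finite"
  assumes Y: "\<forall>\<alpha>. 0 < Y $ \<alpha>" and N: "\<forall>\<alpha>. odd (N $ \<alpha>)"
  shows "csvec (green_op Y N A0 v) = smat_app N (Gamma0 Y N A0) (csvec v)"
  unfolding green_op_def csvec_sample_trigfun[OF Y N green_coeffs_conj_symm[OF N]]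
    Gamma0_def smat_app_mult csmat_diag
  by (rule smat_app_cong) (simp add: smat_app_diag[OF N] green_coeffs_def)

lemma green_op_add:
  fixes Y :: "real^'d::finite"
  assumes "\<forall>\<alpha>. 0 < Y $ \<alpha>" and "\<forall>\<alpha>. odd (N $ \<alpha>)"
  shows "green_op Y N A0 (v + w) = green_op Y N A0 v + green_op Y N A0 w"
  using csvec_green_op[OF assms] by (simp add: csvec_add smat_app_add flip: csvec_eq_iff)

lemma green_op_diff:
  fixes Y :: "real^'d::finite"
  assumes "\<forall>\<alpha>. 0 < Y $ \<alpha>" and "\<forall>\<alpha>. odd (N $ \<alpha>)"
  shows "green_op Y N A0 (v - w) = green_op Y N A0 v - green_op Y N A0 w"
  using csvec_green_op[OF assms] by (simp add: csvec_diff smat_app_diff flip: csvec_eq_iff)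

lemma green_op_in_EEN:
  fixes Y :: "real^'d::finite"
  assumes "\<forall>\<alpha>. 0 < Y $ \<alpha>" and "\<forall>\<alpha>. odd (N $ \<alpha>)"
  shows "green_op Y N A0 v \<in> EEN Y N"
  using green_coeffs_in_grad_coeffs[OF assms(2)]
  unfolding EEN_def EN_space_eq_image[OF assms] green_op_def by blast

text \<open>In Fourier coefficients this is a Hermitian form with real symmetric blocks. Its value
  is real, so conjugation leaves it unchanged and at the same time exchanges \<open>v\<close> and
  \<open>w\<close>.\<close>

lemma svec_inner_green_op:
  fixes Y :: "real^'d::finite"
  assumes Y: "\<forall>\<alpha>. 0 < Y $ \<alpha>" and N: "\<forall>\<alpha>. odd (N $ \<alpha>)"
  shows "svec_inner N v (green_op Y N A0 w) = svec_inner N w (green_op Y N A0 v)"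
proof -
  let ?F = "\<lambda>v m. smat_app N (DFT N) (csvec v) m"
  have eq: "complex_of_real (svec_inner N v (green_op Y N A0 w))
      = (\<Sum>m\<in>ZN N. \<Sum>i\<in>UNIV. \<Sum>j\<in>UNIV. ?F v m $ i * (of_real (Gamma_hat Y A0 m $ i $ j) * cnj (?F w m $ j)))" for v w
    unfolding green_op_def svec_inner_sample_trigfun[OF Y N green_coeffs_conj_symm[OF N]]
    by (simp add: green_coeffs_def matrix_vector_mult_def map_matrix_def sum_distrib_left)
  have "complex_of_real (svec_inner N v (green_op Y N A0 w)) = cnj (complex_of_real (svec_inner N v (green_op Y N A0 w)))"
    by simp
  also have "\<dots> = (\<Sum>m\<in>ZN N. \<Sum>i\<in>UNIV. \<Sum>j\<in>UNIV. cnj (?F v m $ i) * (of_real (Gamma_hat Y A0 m $ i $ j) * ?F w m $ j))"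
    unfolding eq by simp
  also have "\<dots> = (\<Sum>m\<in>ZN N. \<Sum>j\<in>UNIV. \<Sum>i\<in>UNIV. cnj (?F v m $ i) * (of_real (Gamma_hat Y A0 m $ i $ j) * ?F w m $ j))"
    by (intro sum.cong refl sum.swap)
  also have "\<dots> = complex_of_real (svec_inner N w (green_op Y N A0 v))"
    unfolding eq by (intro sum.cong refl) (simp add: Gamma_hat_symmetric mult_ac)
  finally show ?thesis by simp
qed

lemma EEN_subset_svecs: "EEN Y N \<subseteq> svecs N"
  by (auto simp: EEN_def sample_mem_svecs)

lemma green_op_cong:
  "(\<And>k. k \<in> ZN N \<Longrightarrow> v k = w k) \<Longrightarrow> green_op Y N A0 v = green_op Y N A0 w"
  unfolding green_op_def green_coeffs_def
  by (subst smat_app_cong[of N "csvec v" "csvec w"]) (simp_all add: csvec_def)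

text \<open>The quotient \<open>(A0 \<xi>, \<xi>)\<close> cancels on multiples of \<open>\<xi>\<close>.\<close>

lemma green_op_A0:
  fixes Y :: "real^'d::finite"
  assumes Y: "\<forall>\<alpha>. 0 < Y $ \<alpha>" and N: "\<forall>\<alpha>. odd (N $ \<alpha>)"
    and A0: "\<And>v. v \<noteq> 0 \<Longrightarrow> (A0 *v v) \<bullet> v \<noteq> 0" and w: "w \<in> EEN Y N"
  shows "green_op Y N A0 (\<lambda>k. A0 *v w k) = w"
proof -
  obtain c where c: "c \<in> grad_coeffs Y N" and w: "w = sample Y N (trigfun Y N c)"
    using w unfolding EEN_def EN_space_eq_image[OF Y N] by auto
  have cs: "conj_symm N c" using c by (simp add: grad_coeffs_def)
  have "green_coeffs Y N A0 (\<lambda>k. A0 *v w k) k = c k" if k: "k \<in> ZN N" for k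
  proof (cases "k = 0")
    case True
    then show ?thesis using c green_coeffs_in_grad_coeffs[OF N, of Y A0] by (simp add: grad_coeffs_def)
  next
    case False
    then obtain \<beta> where "k $ \<beta> \<noteq> 0" by (auto simp: vec_eq_iff)
    moreover have "0 < Y $ \<beta>" using Y by simp
    ultimately have \<beta>: "xi Y k $ \<beta> \<noteq> 0" by (simp add: xi_def)
    \<comment> \<open>The nonzero component \<beta> of the frequency fixes the factor; the
      parallelism conditions against \<beta> determine all other components of
      \<open>c k\<close>.\<close>
    define p where "p = c k $ \<beta> / of_real (xi Y k $ \<beta>)"
    have ck: "c k = p *s cvec (xi Y k)"
      using c k \<beta> by (simp add: grad_coeffs_def p_def vec_eq_iff divide_simps) (simp add: mult.commute)
    \<comment> \<open>\<open>A0\<close> is the same at every grid point, so it commutes with the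
      transform, whose blocks are scalar.\<close>
    have DFT: "smat_app N (DFT N) (csvec (\<lambda>k. A0 *v w k)) k
        = map_matrix complex_of_real A0 *v smat_app N (DFT N) (csvec w) k"
    proof -
      have "csvec (\<lambda>k. A0 *v w k) = (\<lambda>k. map_matrix complex_of_real A0 *v csvec w k)"
        by (simp add: csvec_def map_matrix_of_real_cvec)
      then show ?thesis
        using k by (simp add: smat_app_def DFT_def mat_vector_mult matrix_vector_mult_sum_right vector_scalar_commute)
    qed
    have xi0: "xi Y k \<noteq> 0" using \<beta> by auto
    have real: "Gamma_hat Y A0 k *v (A0 *v xi Y k) = xi Y k"
    proof -
      have "(\<chi> i j. xi Y k $ i * xi Y k $ j) *v y = (y \<bullet> xi Y k) *\<^sub>R xi Y k" for y
        by (simp add: vec_eq_iff matrix_vector_mult_def inner_vec_def sum_distrib_right sum_distrib_left mult_ac)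
      then have "Gamma_hat Y A0 k *v y = ((y \<bullet> xi Y k) / ((A0 *v xi Y k) \<bullet> xi Y k)) *\<^sub>R xi Y k" for y
        using False by (simp add: Gamma_hat_def scaleR_matrix_vector_assoc[symmetric])
      then show ?thesis using A0[OF xi0] by simp
    qed
    have "green_coeffs Y N A0 (\<lambda>k. A0 *v w k) k
        = map_matrix complex_of_real (Gamma_hat Y A0 k) *v (map_matrix complex_of_real A0 *v c k)"
      unfolding green_coeffs_def DFT unfolding w DFT_sample_trigfun[OF Y N cs k] ..
    also have "\<dots> = p *s cvec (Gamma_hat Y A0 k *v (A0 *v xi Y k))"
      by (simp only: ck vector_scalar_commute map_matrix_of_real_cvec)
    finally show ?thesis by (simp only: real ck)
  qed
  then have "trigfun Y N (green_coeffs Y N A0 (\<lambda>k. A0 *v w k)) = trigfun Y N c"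
    by (rule trigfun_cong)
  then show ?thesis by (simp add: green_op_def w)
qed

text \<open>The transform of a constant vanishes at nonzero frequencies by \<open>sum_omega\<close>,
  and \<open>Gamma_hat\<close> vanishes at the zero frequency.\<close>

lemma green_op_const:
  fixes Y :: "real^'d::finite"
  assumes N: "\<forall>\<alpha>. odd (N $ \<alpha>)"
  shows "green_op Y N A0 (E_vec N E) = 0"
proof -
  have "green_coeffs Y N A0 (E_vec N E) k = 0" if k: "k \<in> ZN N" for k
  proof (cases "k = 0")
    case True
    then show ?thesis using green_coeffs_in_grad_coeffs[OF N, of Y A0] by (simp add: grad_coeffs_def)
  next
    case False
    have "\<bar>(- k) $ \<alpha>\<bar> < int (N $ \<alpha>)" for \<alpha>
    proof -
      have "N $ \<alpha> = 2 * (N $ \<alpha> div 2) + 1" using N by (metis odd_two_times_div_two_succ)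
      moreover have "k $ \<alpha> \<in> {- int (N $ \<alpha> div 2)..int (N $ \<alpha> div 2)}"
        using k by (simp add: ZN_iff[OF N])
      ultimately show ?thesis by auto
    qed
    then have "(\<Sum>m\<in>ZN N. omega N (- k) m) = 0"
      using sum_omega[OF N, of "- k"] False by simp
    then have "smat_app N (DFT N) (csvec (E_vec N E)) k = 0"
      by (simp add: vec_eq_iff smat_app_DFT_nth csvec_def E_vec_def flip: sum_distrib_right)
    then show ?thesis by (simp add: green_coeffs_def)
  qed
  then have "trigfun Y N (green_coeffs Y N A0 (E_vec N E)) = trigfun Y N (\<lambda>k. 0)"
    by (rule trigfun_cong)
  then show ?thesis by (simp add: green_op_def sample_def trigfun_def trig_sum_def fun_eq_iff vec_eq_iff)
qed

section \<open>Unique solvability of the discrete problem\<close>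

text \<open>Orthogonal projection of \<open>f\<close> onto the span of \<open>b ` J\<close>, by Gram--Schmidt. The last conjunct
  expresses membership in that span; the type of functions carries no vector space structure in
  the library.\<close>

lemma orthogonal_projection_finite:
  fixes a :: "('k \<Rightarrow> 'b::real_vector) \<Rightarrow> ('k \<Rightarrow> 'b) \<Rightarrow> real"
  assumes "finite J"
    and lin: "\<And>u v t w. a (\<lambda>k. u k + t *\<^sub>R v k) w = a u w + t * a v w"
    and sym: "\<And>u v. a u v = a v u"
    and defn: "\<And>u v. a u u = 0 \<Longrightarrow> a v u = 0"
    and W: "\<And>u v t. u \<in> W \<Longrightarrow> v \<in> W \<Longrightarrow> (\<lambda>k. u k + t *\<^sub>R v k) \<in> W"
    and "(\<lambda>k. 0) \<in> W" and "b ` J \<subseteq> W"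
  shows "\<exists>e\<in>W. (\<forall>j\<in>J. a e (b j) = a f (b j)) \<and> (\<forall>z. (\<forall>j\<in>J. a z (b j) = 0) \<longrightarrow> a z e = 0)"
  using assms(1) assms(7)
proof (induction J arbitrary: f rule: finite_induct)
  case empty
  have "a (\<lambda>k. 0) z = 0" for z
    using lin[of "\<lambda>k. 0" 1 "\<lambda>k. 0" z] by simp
  then show ?case using assms(6) sym[of _ "\<lambda>k. 0"] by auto
next
  case (insert i J)
  have bi: "b i \<in> W" and J: "b ` J \<subseteq> W" using insert.prems by auto
  obtain e where e: "e \<in> W" "\<And>j. j \<in> J \<Longrightarrow> a e (b j) = a f (b j)"
    "\<And>z. (\<And>j. j \<in> J \<Longrightarrow> a z (b j) = 0) \<Longrightarrow> a z e = 0"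
    using insert.IH[OF J, of f] by blast
  obtain p where p: "p \<in> W" "\<And>j. j \<in> J \<Longrightarrow> a p (b j) = a (b i) (b j)"
    "\<And>z. (\<And>j. j \<in> J \<Longrightarrow> a z (b j) = 0) \<Longrightarrow> a z p = 0"
    using insert.IH[OF J, of "b i"] by blast
  have lin': "a w (\<lambda>k. u k + t *\<^sub>R v k) = a w u + t * a w v" for u v w t
    using lin[of u t v w] by (simp add: sym[of w])
  \<comment> \<open>\<open>q\<close> is the part of the new vector orthogonal to the old ones,
    \<open>r\<close> the residual of \<open>f\<close>; the old projection \<open>e\<close> is
    corrected only along \<open>q\<close>.\<close>
  define q where "q = (\<lambda>k. b i k + (- 1) *\<^sub>R p k)"
  define r where "r = (\<lambda>k. f k + (- 1) *\<^sub>R e k)"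
  define t where "t = a r q / a q q"
  define e' where "e' = (\<lambda>k. e k + t *\<^sub>R q k)"
  have q: "a z q = a z (b i) - a z p" for z
    using lin'[of z "b i" "- 1" p] by (simp add: q_def)
  have r: "a r z = a f z - a e z" for z
    using lin[of f "- 1" e z] by (simp add: r_def)
  have qJ: "a q (b j) = 0" if "j \<in> J" for j
    using p(2)[OF that] lin[of "b i" "- 1" p "b j"] by (simp add: q_def)
  have rp: "a r p = 0" by (rule p(3)) (simp add: r e(2))
  have qp: "a q p = 0" by (rule p(3)) (rule qJ)
  have e': "a e' z = a e z + t * a q z" "a z e' = a z e + t * a z q" for z
    unfolding e'_def by (rule lin lin')+
  \<comment> \<open>If \<open>a q q = 0\<close>, then \<open>t = 0\<close> by the convention for
    division, and \<open>a r q = 0\<close> by the assumed degenerate case.\<close>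
  have "t * a q q = a r q"
    using defn[of q r] by (simp add: t_def)
  then have "a e' (b i) = a f (b i)"
    using q[of r] rp r[of "b i"] q[of q] qp by (simp add: e')
  moreover have "a e' (b j) = a f (b j)" if "j \<in> J" for j
    using qJ[OF that] e(2)[OF that] by (simp add: e')
  moreover have "a z e' = 0" if z: "\<And>j. j \<in> insert i J \<Longrightarrow> a z (b j) = 0" for z
  proof -
    have "a z e = 0" "a z p = 0" using z by (auto intro: e(3) p(3))
    then show ?thesis using q[of z] z by (simp add: e')
  qed
  moreover have "e' \<in> W"
    unfolding e'_def q_def by (intro W e(1) p(1) bi)
  ultimately show ?case by blast
qed

text \<open>With the identity as reference, \<open>green_op\<close> is a projection onto
  \<open>EEN\<close>. As the fixed points of a linear map, \<open>EEN\<close> is a subspace.\<close>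

lemma EEN_eq_fixpoints:
  fixes Y :: "real^'d::finite"
  assumes Y: "\<forall>\<alpha>. 0 < Y $ \<alpha>" and N: "\<forall>\<alpha>. odd (N $ \<alpha>)"
  shows "EEN Y N = {w. green_op Y N (mat 1) w = w}"
  using green_op_A0[OF Y N, of "mat 1"] green_op_in_EEN[OF Y N, of "mat 1"]
  by (auto simp: matrix_vector_mul_lid) (metis)

lemma EEN_closed:
  fixes Y :: "real^'d::finite"
  assumes Y: "\<forall>\<alpha>. 0 < Y $ \<alpha>" and N: "\<forall>\<alpha>. odd (N $ \<alpha>)" and "u \<in> EEN Y N" "v \<in> EEN Y N"
  shows "(\<lambda>k. u k + t *\<^sub>R v k) \<in> EEN Y N"
proof -
  have "csvec (\<lambda>k. t *\<^sub>R w k) = (\<lambda>k. of_real t *s csvec w k)" for w :: "(real, 'd) svec"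
    by (simp add: csvec_def fun_eq_iff vec_eq_iff)
  moreover have "smat_app N M (\<lambda>k. c *s w k) = (\<lambda>k. c *s smat_app N M w k)" for M c and w :: "(complex, 'd) svec"
    by (simp add: smat_app_def fun_eq_iff vector_scalar_commute vec_eq_iff sum_distrib_left)
  ultimately have "green_op Y N (mat 1) (\<lambda>k. t *\<^sub>R w k) = (\<lambda>k. t *\<^sub>R green_op Y N (mat 1) w k)" for w
    by (simp add: csvec_green_op[OF Y N] flip: csvec_eq_iff)
  then show ?thesis
    using assms green_op_add[OF Y N, of "mat 1" u "\<lambda>k. t *\<^sub>R v k"]
    by (simp add: EEN_eq_fixpoints[OF Y N] plus_fun_def)
qed

lemma discrete_sol_iff_green_op:
  fixes Y :: "real^'d::finite"
  assumes Y: "\<forall>\<alpha>. 0 < Y $ \<alpha>" and N: "\<forall>\<alpha>. odd (N $ \<alpha>)"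
    and A0: "\<And>v. v \<noteq> 0 \<Longrightarrow> (A0 *v v) \<bullet> v \<noteq> 0"
  shows "discrete_sol Y N A E e \<longleftrightarrow>
    e \<in> EEN Y N \<and> green_op Y N A0 (smat_app N (A_mat Y N A) (E_vec N E + e)) = 0"
proof -
  define f where "f = smat_app N (A_mat Y N A) (E_vec N E + e)"
  have "svec_inner N (smat_app N (A_mat Y N A) e) v = - svec_inner N (smat_app N (A_mat Y N A) (E_vec N E)) v
      \<longleftrightarrow> svec_inner N f v = 0" for v
    by (auto simp: f_def smat_app_add svec_inner_add_left)
  then have "discrete_sol Y N A E e \<longleftrightarrow> e \<in> EEN Y N \<and> (\<forall>v\<in>EEN Y N. svec_inner N f v = 0)"
    by (simp add: discrete_sol_def)
  moreover have "(\<forall>v\<in>EEN Y N. svec_inner N f v = 0) \<longleftrightarrow> green_op Y N A0 f = 0"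
  proof
    assume "\<forall>v\<in>EEN Y N. svec_inner N f v = 0"
    \<comment> \<open>Applying \<Gamma> twice to \<open>f\<close> gives the right test vector:
      symmetry moves one factor to the left and leaves the squared norm of \<Gamma> f.\<close>
    then have "svec_inner N f (green_op Y N A0 (green_op Y N A0 f)) = 0"
      using green_op_in_EEN[OF Y N] by blast
    then have "svec_inner N (green_op Y N A0 f) (green_op Y N A0 f) = 0"
      by (simp add: svec_inner_green_op[OF Y N, of f])
    then show "green_op Y N A0 f = 0"
      by (intro svec_inner_self_eq_0[OF N]) (simp_all add: green_op_def sample_mem_svecs)
  next
    assume 0: "green_op Y N A0 f = 0"
    show "\<forall>v\<in>EEN Y N. svec_inner N f v = 0"
    proof
      fix v assume "v \<in> EEN Y N"
      from green_op_A0[OF Y N A0 this]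
      have "svec_inner N f v = svec_inner N f (green_op Y N A0 (\<lambda>k. A0 *v v k))" by simp
      also have "\<dots> = 0"
        by (simp add: svec_inner_green_op[OF Y N, of f] 0) (simp add: svec_inner_def)
      finally show "svec_inner N f v = 0" .
    qed
  qed
  ultimately show ?thesis by (simp add: f_def)
qed

text \<open>The solution is the projection of the constant -\<open>E\<close> onto \<open>EEN\<close>
  in the energy product of \<open>A\<close>. The vectors \<Gamma> \<open>D\<close> serve as spanning
  set, but that they span is never shown: by symmetry of \<Gamma>, orthogonality of the residual to
  them says that each entry of \<Gamma> f vanishes, and this is the criterion already
  proved.\<close>

lemma discrete_sol_ex1:
  fixes Y :: "real^'d::finite"
  assumes Y: "\<forall>\<alpha>. 0 < Y $ \<alpha>" and N: "\<forall>\<alpha>. odd (N $ \<alpha>)"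
    and sym: "\<And>k. k \<in> ZN N \<Longrightarrow> transpose (A (grid Y N k)) = A (grid Y N k)"
    and pos: "\<And>k v. k \<in> ZN N \<Longrightarrow> v \<noteq> 0 \<Longrightarrow> 0 < (A (grid Y N k) *v v) \<bullet> v"
  shows "\<exists>!e. discrete_sol Y N A E e"
proof -
  define a where "a u v = (\<Sum>k\<in>ZN N. (A (grid Y N k) *v u k) \<bullet> v k)" for u v :: "(real, 'd) svec"
  have inner: "svec_inner N (smat_app N (A_mat Y N A) u) v = a u v / Ntot N" for u v
    by (simp add: svec_inner_def smat_app_A_mat[OF N] a_def)
  have lin: "a (\<lambda>k. u k + t *\<^sub>R v k) w = a u w + t * a v w" for u v w t
    by (simp add: a_def matrix_vector_right_distrib inner_add_left sum.distrib sum_distrib_left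
        matrix_vector_mult_scaleR)
  have a_sym: "a u v = a v u" for u v
    unfolding a_def
  proof (intro sum.cong refl)
    fix k assume k: "k \<in> ZN N"
    have "(A (grid Y N k) *v u k) \<bullet> v k = (transpose (A (grid Y N k)) *v v k) \<bullet> u k"
      by (simp only: transpose_matrix_vector dot_lmul_matrix) (rule inner_commute)
    then show "(A (grid Y N k) *v u k) \<bullet> v k = (A (grid Y N k) *v v k) \<bullet> u k"
      by (simp only: sym[OF k])
  qed
  have nonneg: "0 \<le> (A (grid Y N k) *v v) \<bullet> v" if "k \<in> ZN N" for k v
    using pos[OF that, of v] by (cases "v = 0") auto
  have a_zero: "u k = 0" if "a u u = 0" "k \<in> ZN N" for u k
  proof -
    have "(A (grid Y N k) *v u k) \<bullet> u k = 0"
      using that nonneg finite_ZN[OF N] unfolding a_def by (subst (asm) sum_nonneg_eq_0_iff) auto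
    then show ?thesis using pos[OF that(2), of "u k"] by auto
  qed
  \<comment> \<open>\<open>a\<close> sees only indices in \<open>ZN N\<close>, so it is definite
    only up to the other entries; hence the projection lemma asks for this weaker property.\<close>
  have a_def0: "a v u = 0" if "a u u = 0" for u v
    using a_zero[OF that] by (simp add: a_def)
  define D :: "(int^'d) \<times> 'd \<Rightarrow> (real, 'd) svec" where "D = (\<lambda>(m, i) k. if k = m then axis i 1 else 0)"
  define b where "b j = green_op Y N (mat 1) (D j)" for j
  have zero: "(\<lambda>k. 0) \<in> EEN Y N"
    using green_op_in_EEN[OF Y N, of "mat 1" "E_vec N 0"] by (simp add: green_op_const[OF N] zero_fun_def)
  have range: "b ` (ZN N \<times> UNIV) \<subseteq> EEN Y N"
    using green_op_in_EEN[OF Y N] by (auto simp: b_def)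
  have fin: "finite (ZN N \<times> (UNIV :: 'd set))" using finite_ZN[OF N] by simp
  have "\<exists>e\<in>EEN Y N. (\<forall>j\<in>ZN N \<times> UNIV. a e (b j) = a (\<lambda>k. - E_vec N E k) (b j)) \<and>
      (\<forall>z. (\<forall>j\<in>ZN N \<times> UNIV. a z (b j) = 0) \<longrightarrow> a z e = 0)"
    by (rule orthogonal_projection_finite[where a = a, OF fin lin a_sym a_def0 EEN_closed[OF Y N] zero range])
  then obtain e where e: "e \<in> EEN Y N"
    and e_b: "\<And>j. j \<in> ZN N \<times> UNIV \<Longrightarrow> a e (b j) = a (\<lambda>k. - E_vec N E k) (b j)"
    by blast
  have a_neg: "a (\<lambda>k. - v k) w = - a v w" for v w
    using lin[of "\<lambda>k. 0" "- 1" v w] lin[of "\<lambda>k. 0" 1 "\<lambda>k. 0" w] by simp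
  have a_add: "a (u + v) w = a u w + a v w" for u v w
    using lin[of u 1 v w] by (simp add: plus_fun_def)
  define f where "f = smat_app N (A_mat Y N A) (E_vec N E + e)"
  have "green_op Y N (mat 1) f = 0"
  proof (rule svecs_eqI)
    fix m assume m: "m \<in> ZN N"
    have "green_op Y N (mat 1) f m $ i = 0" for i
    proof -
      have "a (E_vec N E + e) (b (m, i)) = 0"
        using e_b[of "(m, i)"] m by (simp add: a_add a_neg)
      then have "svec_inner N f (b (m, i)) = 0" by (simp add: f_def inner)
      then have "svec_inner N (D (m, i)) (green_op Y N (mat 1) f) = 0"
        by (simp add: b_def svec_inner_green_op[OF Y N, of f])
      moreover have "(\<Sum>k\<in>ZN N. D (m, i) k \<bullet> green_op Y N (mat 1) f k)
          = (\<Sum>k\<in>ZN N. if k = m then green_op Y N (mat 1) f m $ i else 0)"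
        by (intro sum.cong refl) (simp add: D_def inner_axis')
      ultimately show ?thesis
        using m Ntot_pos[OF N] finite_ZN[OF N] by (simp add: svec_inner_def)
    qed
    then show "green_op Y N (mat 1) f m = 0 m" by (simp add: vec_eq_iff)
  qed (simp_all add: green_op_def sample_mem_svecs, simp add: svecs_def)
  then have sol: "discrete_sol Y N A E e"
    using e discrete_sol_iff_green_op[OF Y N, of "mat 1"] by (simp add: f_def)
  moreover have "e' = e" if sol': "discrete_sol Y N A E e'" for e'
  proof (rule svecs_eqI)
    have mem: "e \<in> EEN Y N" "e' \<in> EEN Y N" using sol sol' by (auto simp: discrete_sol_def)
    then show "e' \<in> svecs N" "e \<in> svecs N" using EEN_subset_svecs by auto
    \<comment> \<open>Both equations are tested with the difference of the solutions, written in the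
      shape that \<open>EEN_closed\<close> and \<open>lin\<close> expect.\<close>
    define d where "d = (\<lambda>k. e' k + (- 1) *\<^sub>R e k)"
    have "d \<in> EEN Y N" unfolding d_def using mem by (intro EEN_closed[OF Y N])
    then have "a e' d / Ntot N = a e d / Ntot N"
      using sol sol' unfolding discrete_sol_def inner by simp
    moreover have "a d w = a e' w - a e w" for w
      using lin[of e' "- 1" e w] by (simp add: d_def)
    ultimately have "a d d = 0" using Ntot_pos[OF N] by simp
    then show "e' k = e k" if "k \<in> ZN N" for k
      using a_zero[of d k] that by (simp add: d_def)
  qed
  ultimately show ?thesis by blast
qed

text \<open>The equation exhibits \<open>e - E_vec N E\<close> as a value of \<Gamma>, so membership
  in \<open>EEN\<close> is a consequence of it. On such \<open>e\<close> the term \<Gamma> A0 e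
  equals \<open>e - E_vec N E\<close>, because \<Gamma> A0 fixes \<open>EEN\<close> and annihilates
  constants; what remains is \<Gamma> A e = 0.\<close>

lemma lippmann_schwinger_sol_iff:
  fixes Y :: "real^'d::finite"
  assumes Y: "\<forall>\<alpha>. 0 < Y $ \<alpha>" and N: "\<forall>\<alpha>. odd (N $ \<alpha>)"
    and A0: "\<And>v. v \<noteq> 0 \<Longrightarrow> (A0 *v v) \<bullet> v \<noteq> 0"
  shows "lippmann_schwinger_sol Y N A A0 E e \<longleftrightarrow> discrete_sol Y N A E (e - E_vec N E)"
proof -
  let ?G = "green_op Y N A0" and ?A = "smat_app N (A_mat Y N A)"
  have A0_app: "smat_app N (A0_mat A0) v = (\<lambda>k. if k \<in> ZN N then A0 *v v k else 0)" for v
    by (simp add: A0_mat_def smat_app_diag[OF N])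
  have G0: "?G (smat_app N (A0_mat A0) w) = w" if "w \<in> EEN Y N" for w
    using green_op_A0[OF Y N A0 that] by (subst green_op_cong[of N _ "\<lambda>k. A0 *v w k"]) (simp_all add: A0_app)
  have GE: "?G (smat_app N (A0_mat A0) (E_vec N E)) = 0"
    using green_op_const[OF N, of Y A0 "A0 *v E"]
    by (subst green_op_cong[of N _ "E_vec N (A0 *v E)"]) (simp_all add: A0_app E_vec_def)
  have "smat_app N (smat_id + smat_mult N (Gamma0 Y N A0) (csmat (A_mat Y N A - A0_mat A0))) (csvec e)
      = csvec (e + (?G (?A e) - ?G (smat_app N (A0_mat A0) e)))" if "e \<in> svecs N"
  proof -
    have "smat_app N smat_id (csvec e) = csvec e"
      using that by (simp add: smat_id_def smat_app_diag[OF N] fun_eq_iff csvec_def svecs_def vec_eq_iff)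
    then show ?thesis
      by (simp add: smat_app_add_mat smat_app_mult smat_app_csmat smat_app_diff_mat csvec_add
          green_op_diff[OF Y N, symmetric] csvec_green_op[OF Y N])
  qed
  then have LS: "lippmann_schwinger_sol Y N A A0 E e \<longleftrightarrow>
      e \<in> svecs N \<and> e + (?G (?A e) - ?G (smat_app N (A0_mat A0) e)) = E_vec N E"
    by (auto simp: lippmann_schwinger_sol_def csvec_eq_iff)
  have GA0: "?G (smat_app N (A0_mat A0) e) = e - E_vec N E" if "e - E_vec N E \<in> EEN Y N"
    using G0[OF that] GE by (simp add: smat_app_diff green_op_diff[OF Y N])
  have DS: "discrete_sol Y N A E (e - E_vec N E) \<longleftrightarrow> e - E_vec N E \<in> EEN Y N \<and> ?G (?A e) = 0"
    using discrete_sol_iff_green_op[OF Y N A0] by simp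
  show ?thesis
  proof
    assume "lippmann_schwinger_sol Y N A A0 E e"
    then have eq: "e + (?G (?A e) - ?G (smat_app N (A0_mat A0) e)) = E_vec N E" by (simp add: LS)
    then have "e - E_vec N E = ?G (smat_app N (A0_mat A0) e) - ?G (?A e)" by (simp add: algebra_simps)
    then have mem: "e - E_vec N E \<in> EEN Y N"
      using green_op_in_EEN[OF Y N] by (metis green_op_diff[OF Y N])
    with eq GA0 show "discrete_sol Y N A E (e - E_vec N E)"
      by (simp add: DS algebra_simps)
  next
    assume "discrete_sol Y N A E (e - E_vec N E)"
    then have mem: "e - E_vec N E \<in> EEN Y N" and 0: "?G (?A e) = 0" by (simp_all add: DS)
    have "e = (e - E_vec N E) + E_vec N E" by simp
    moreover have "e - E_vec N E \<in> svecs N" using mem EEN_subset_svecs by blast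
    ultimately have "e \<in> svecs N"
      using E_vec_mem_svecs[of N E] by (simp add: svecs_def)
    then show "lippmann_schwinger_sol Y N A A0 E e"
      using GA0[OF mem] 0 by (simp add: LS)
  qed
qed

section \<open>The projected system, and the coefficient at the grid points\<close>

lemma smat_app_G_mat:
  fixes Y :: "real^'d::finite"
  assumes Y: "\<forall>\<alpha>. 0 < Y $ \<alpha>" and N: "\<forall>\<alpha>. odd (N $ \<alpha>)"
  shows "smat_app N (smat_mult N (G_mat Y N) (csmat M)) (csvec v)
    = csvec (green_op Y N (mat 1) (smat_app N M v))"
proof -
  have "smat_app N (A0_mat (mat 1)) (smat_app N M v) = smat_app N M v"
    by (simp add: A0_mat_def smat_app_diag[OF N] fun_eq_iff) (simp add: smat_app_def)
  then show ?thesis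
    by (simp add: G_mat_def G0_mat_def smat_app_mult smat_app_csmat csvec_green_op[OF Y N])
qed

text \<open>For odd \<open>N $ \<alpha>\<close> the integer \<open>2 * k $ \<alpha>\<close> stays
  strictly below \<open>N $ \<alpha>\<close> in modulus, so no node lies on a face. Each node thus
  has a neighbourhood inside the cell, where the bounds hold almost everywhere.\<close>

lemma grid_mem_interior:
  fixes Y :: "real^'d::finite"
  assumes Y: "\<forall>\<alpha>. 0 < Y $ \<alpha>" and N: "\<forall>\<alpha>. odd (N $ \<alpha>)" and k: "k \<in> ZN N"
  shows "grid Y N k \<in> box (- Y) Y"
proof -
  have "- Y $ \<alpha> < of_int (k $ \<alpha>) * (2 * Y $ \<alpha> / real (N $ \<alpha>))
      \<and> of_int (k $ \<alpha>) * (2 * Y $ \<alpha> / real (N $ \<alpha>)) < Y $ \<alpha>" for \<alpha>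
  proof -
    obtain M where M: "N $ \<alpha> = 2 * M + 1" using N oddE by blast
    have "k $ \<alpha> \<in> {- int (N $ \<alpha> div 2)..int (N $ \<alpha> div 2)}" using k by (simp add: ZN_iff[OF N])
    then have "\<bar>2 * real_of_int (k $ \<alpha>)\<bar> < real (N $ \<alpha>)" using M by auto
    then have "\<bar>2 * real_of_int (k $ \<alpha>)\<bar> * Y $ \<alpha> < real (N $ \<alpha>) * Y $ \<alpha>"
      using Y by (intro mult_strict_right_mono) auto
    then have "\<bar>2 * real_of_int (k $ \<alpha>) * Y $ \<alpha>\<bar> < real (N $ \<alpha>) * Y $ \<alpha>"
      using Y by (simp add: abs_mult less_imp_le)
    then show ?thesis using M by (simp add: abs_less_iff field_simps)
  qed
  then show ?thesis by (simp add: mem_box_cart grid_def)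
qed

text \<open>By continuity the points with symmetry and the lower bound form a closed set, an
  intersection over entries and vectors of closed conditions. A closed set that contains almost
  every point of an open set contains all of it.\<close>

lemma matrix_bounds_on_interior:
  fixes A :: "real^'d::finite \<Rightarrow> real^'d^'d"
  assumes cont: "continuous_on UNIV A"
    and AE: "AE x in lebesgue. x \<in> cell Y \<longrightarrow>
      transpose (A x) = A x \<and> (\<forall>v. c * (norm v)\<^sup>2 \<le> (A x *v v) \<bullet> v \<and> (A x *v v) \<bullet> v \<le> C * (norm v)\<^sup>2)"
    and x: "x \<in> box (- Y) Y"
  shows "transpose (A x) = A x" and "c * (norm v)\<^sup>2 \<le> (A x *v v) \<bullet> v"
proof -
  have comp: "continuous_on UNIV (\<lambda>x. A x $ i $ j)" for i j
    using cont by (intro continuous_intros)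
  define K where "K = (\<Inter>i. \<Inter>j. {x. A x $ j $ i = A x $ i $ j}) \<inter> (\<Inter>v. {x. c * (norm v)\<^sup>2 \<le> (A x *v v) \<bullet> v})"
  have "closed K"
    unfolding K_def matrix_vector_mult_def inner_vec_def vec_lambda_beta
    by (intro closed_Int closed_INT ballI closed_Collect_eq closed_Collect_le continuous_intros comp)
  moreover have "AE x\<in>box (- Y) Y in lebesgue. x \<in> K"
    using AE
  proof eventually_elim
    case (elim x)
    then show ?case
      using box_subset_cbox[of "- Y" Y] by (auto simp: K_def cell_def transpose_def vec_eq_iff)
  qed
  ultimately have "x \<in> K"
    by (intro mem_closed_if_AE_lebesgue_open[OF open_box _ _ x])
  then show "transpose (A x) = A x" "c * (norm v)\<^sup>2 \<le> (A x *v v) \<bullet> v"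
    by (auto simp: K_def transpose_def vec_eq_iff)
qed

theorem proposition12:
  fixes Y :: "real^'d::finite" and N :: "nat^'d" and E :: "real^'d"
    and A :: "real^'d \<Rightarrow> real^'d^'d" and A0 :: "real^'d^'d"
    and cA CA cA0 CA0 :: real
  assumes "\<forall>\<alpha>. 0 < Y $ \<alpha>"
    and "\<forall>\<alpha>. odd (N $ \<alpha>)"
    and "A \<in> C0_per Y"
    and "0 < cA" and "cA \<le> CA"
    and "AE x in lebesgue. x \<in> cell Y \<longrightarrow>
           transpose (A x) = A x \<and>
           (\<forall>v. cA * (norm v)\<^sup>2 \<le> (A x *v v) \<bullet> v \<and> (A x *v v) \<bullet> v \<le> CA * (norm v)\<^sup>2)"
    and "0 < cA0" and "cA0 \<le> CA0"
    and "transpose A0 = A0"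
    and "\<forall>v. cA0 * (norm v)\<^sup>2 \<le> (A0 *v v) \<bullet> v \<and> (A0 *v v) \<bullet> v \<le> CA0 * (norm v)\<^sup>2"
  shows "(\<exists>!u. galerkin_ni_sol Y N A E u) \<and>
    (\<forall>u. galerkin_ni_sol Y N A E u \<longrightarrow>
      ((\<exists>!e. discrete_sol Y N A E e) \<and> discrete_sol Y N A E (sample Y N u)) \<and>
      ((\<exists>!e. lippmann_schwinger_sol Y N A A0 E e) \<and>
        (\<forall>e et. lippmann_schwinger_sol Y N A A0 E e \<longrightarrow> discrete_sol Y N A E et \<longrightarrow>
           e = E_vec N E + et)) \<and>
      (\<forall>lam>0. A0 = mat lam \<longrightarrow>
        (\<forall>e\<in>EEN Y N. discrete_sol Y N A E e \<longleftrightarrow>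
           smat_app N (smat_mult N (G_mat Y N) (csmat (A_mat Y N A))) (csvec e) =
           - smat_app N (smat_mult N (G_mat Y N) (csmat (A_mat Y N A))) (csvec (E_vec N E)))))"
proof -
  note Y = assms(1) and N = assms(2)
  have cont: "continuous_on UNIV A" using assms(3) by (simp add: C0_per_def)
  have ex1: "\<exists>!e. discrete_sol Y N A E e"
  proof (rule discrete_sol_ex1[OF Y N])
    fix k assume k: "k \<in> ZN N"
    note A = matrix_bounds_on_interior[OF cont assms(6) grid_mem_interior[OF Y N k]]
    show "transpose (A (grid Y N k)) = A (grid Y N k)" by (rule A(1))
    show "0 < (A (grid Y N k) *v v) \<bullet> v" if "v \<noteq> 0" for v
      using that assms(4) by (intro less_le_trans[OF _ A(2)[of v]]) simp
  qed
  have A0: "(A0 *v v) \<bullet> v \<noteq> 0" if "v \<noteq> 0" for v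
  proof -
    have "0 < cA0 * (norm v)\<^sup>2" using that assms(7) by simp
    also have "\<dots> \<le> (A0 *v v) \<bullet> v" using assms(10) by blast
    finally show ?thesis by simp
  qed
  obtain e where e: "discrete_sol Y N A E e" and uniq: "\<And>e'. discrete_sol Y N A E e' \<Longrightarrow> e' = e"
    using ex1 by blast
  have "\<exists>!u. galerkin_ni_sol Y N A E u"
  \<comment> \<open>The discrete solution has a preimage under \<open>sample\<close> because it lies
    in \<open>EEN\<close>, and only one because sampling is injective.\<close>
  proof -
    obtain u where u: "u \<in> EN_space Y N" "e = sample Y N u"
      using e by (auto simp: discrete_sol_def EEN_def)
    show ?thesis
    proof
      show "galerkin_ni_sol Y N A E u" using u e by (simp add: galerkin_ni_sol_iff[OF Y N])
      fix v assume "galerkin_ni_sol Y N A E v"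
      then have "v \<in> EN_space Y N" "sample Y N v = sample Y N u"
        using uniq u by (auto simp: galerkin_ni_sol_iff[OF Y N])
      then show "v = u" using u inj_on_sample_EN_space[OF Y N] by (auto dest: inj_onD)
    qed
  qed
  moreover note LS = lippmann_schwinger_sol_iff[OF Y N A0]
  have LS_eq: "e' = E_vec N E + e" if "lippmann_schwinger_sol Y N A A0 E e'" for e'
  proof -
    have "e' - E_vec N E = e" using that uniq by (simp add: LS)
    then show ?thesis by (simp add: algebra_simps)
  qed
  have "lippmann_schwinger_sol Y N A A0 E (E_vec N E + e)"
    using e by (simp add: LS)
  then have "\<exists>!e'. lippmann_schwinger_sol Y N A A0 E e'" using LS_eq by blast
  moreover have "discrete_sol Y N A E e' \<longleftrightarrow>
           smat_app N (smat_mult N (G_mat Y N) (csmat (A_mat Y N A))) (csvec e') =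
           - smat_app N (smat_mult N (G_mat Y N) (csmat (A_mat Y N A))) (csvec (E_vec N E))"
    if "e' \<in> EEN Y N" for e'
    \<comment> \<open>\<open>G_mat\<close> acts as \<Gamma> with the identity as reference, so the
      criterion for that reference, split by linearity, is the projected system.\<close>
    using that discrete_sol_iff_green_op[OF Y N, of "mat 1" A E e']
    by (simp add: smat_app_G_mat[OF Y N] smat_app_add green_op_add[OF Y N] add_eq_0_iff
        csvec_eq_iff flip: csvec_uminus)
  ultimately show ?thesis
    using ex1 uniq LS_eq by (auto simp: galerkin_ni_sol_iff[OF Y N])
qed

end
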